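(* The following are equivalent for a finitely generated multiplicative system $(X,\mu,S)$: (i) $S$ is pretentiously weak-mixing. (ii) $\mathcal{H}_1$ consists of constant functions and $\mathcal{H}_f=\{0\}$ for any $f\in\mathcal{M}^{\mathrm c}_{\mathrm{fg}}$ with $\mathbb{D}(f,1)=\infty$. (iii) $S$ is pretentiously ergodic and $\sigma_{\mathrm{pr}}(S)=\mathcal{A}_1$. (iv) $S$ has no non-constant pretentious eigenfunctions.
   Context: $\mathbb{N}=\{1,2,\dots\}$, $\mathbb{P}$ is the set of primes, $\mathbb{S}^1$ the complex unit circle. Every probability space $(X,\mu)$ is assumed regular: $X$ is a compact metric space with its Borel $\sigma$-algebra. A multiplicative system $(X,\mu,S)$ consists of a probability space $(X,\mu)$ and a sequence $S=(S_n)_{n\in\mathbb{N}}$ of commuting invertible measure-preserving transformations of $(X,\mu)$ with $S_{nm}=S_n\circ S_m$ for all $n,m\in\mathbb{N}$. It is finitely generated if $\{S_p:p\in\mathbb{P}\}$ is finite. For $F\in L^2(X)$, $S_nF=F\circ S_n$. "Constant" means $\mu$-almost everywhere constant. $\mathcal{M}^{\mathrm c}$ is the set of completely multiplicative $f:\mathbb{N}\to\mathbb{S}^1$, and $\mathcal{M}^{\mathrm c}_{\mathrm{fg}}$ the subset of those with $\{f(p):p\in\mathbb{P}\}$ finite. For $f\in\mathcal{M}^{\mathrm c}$ and $F\in L^2(X)$, $\mathbb{D}_F(S,f)=\big(\frac12\sum_{p\in\mathbb{P}}\frac{\|S_pF-f(p)F\|_2^2}{p}\big)^{1/2}\in[0,\infty]$,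 $\mathcal{H}_f=\{F\in L^2(X):\mathbb{D}_F(S,f)<\infty\}$, $\mathbb{D}(S,f)=\inf_{\|F\|_2=1}\mathbb{D}_F(S,f)$. $F$ is a pretentious eigenfunction if $F\in\mathcal{H}_f$ for some $f\in\mathcal{M}^{\mathrm c}$. For $f,g\in\mathcal{M}^{\mathrm c}$, $\mathbb{D}(f,g)=\big(\sum_{p\in\mathbb{P}}\frac{1-\mathrm{Re}(f(p)\overline{g(p)})}{p}\big)^{1/2}\in[0,\infty]$ and $\mathcal{A}_f=\{g\in\mathcal{M}^{\mathrm c}:\mathbb{D}(f,g)<\infty\}$. The pretentious spectrum is $\sigma_{\mathrm{pr}}(S)=\bigcup_{f\in\mathcal{M}^{\mathrm c}:\,\mathbb{D}(S,f)<\infty}\mathcal{A}_f$. A finitely generated system is pretentiously ergodic if every measurable $A$ with $\mathbf{1}_A\in\mathcal{H}_1$ has measure $0$ or $1$. $S$ is pretentiously weak-mixing if the multiplicative action $S\times S=(S_n\times S_n)_{n\in\mathbb{N}}$ on $(X\times X,\mu\times\mu)$ is pretentiously ergodic. *)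

theory Defs
  imports "HOL-Probability.Probability" "HOL-Computational_Algebra.Primes"
begin

text \<open>The positive integers are rendered as type \<^typ>\<open>nat\<close> with the guard \<open>n \<ge> 1\<close>. Values at \<open>0\<close>
  are left unconstrained; every notion below depends only on the values at positive integers.\<close>

text \<open>The carrier \<^term>\<open>space M\<close> may be any compact subset of a metric space, with its relative
  Borel sets. Identities between transformations hold at every point of the carrier, and
  nothing is required of the maps off the carrier.\<close>

locale multiplicative_system = prob_space M
  for M :: "'a::metric_space measure" and S :: "nat \<Rightarrow> 'a \<Rightarrow> 'a" +
  assumes compact_space: "compact (space M)"
    and sets_borel: "sets M = sets (restrict_space borel (space M))"
    and measure_preserving: "n \<ge> 1 \<Longrightarrow> S n \<in> M \<rightarrow>\<^sub>M M \<and> distr M M (S n) = M"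
    and invertible: "n \<ge> 1 \<Longrightarrow>
      \<exists>T \<in> M \<rightarrow>\<^sub>M M. \<forall>x\<in>space M. T (S n x) = x \<and> S n (T x) = x"
    and commuting: "\<lbrakk>n \<ge> 1; m \<ge> 1; x \<in> space M\<rbrakk> \<Longrightarrow> S n (S m x) = S m (S n x)"
    and multiplicative: "\<lbrakk>n \<ge> 1; m \<ge> 1; x \<in> space M\<rbrakk> \<Longrightarrow> S (n * m) x = S n (S m x)"

definition finitely_generated :: "'a measure \<Rightarrow> (nat \<Rightarrow> 'a \<Rightarrow> 'a) \<Rightarrow> bool" where
  "finitely_generated M S \<longleftrightarrow> finite ((\<lambda>p. restrict (S p) (space M)) ` {p. prime p})"

text \<open>Elements of the Hilbert space are represented by functions; equality in it is equality
  almost everywhere.\<close>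

definition L2 :: "'a measure \<Rightarrow> ('a \<Rightarrow> complex) set" where
  "L2 M = {F \<in> borel_measurable M. integrable M (\<lambda>x. (cmod (F x))\<^sup>2)}"

definition L2_nrm :: "'a measure \<Rightarrow> ('a \<Rightarrow> complex) \<Rightarrow> real" where
  "L2_nrm M F = sqrt (LINT x|M. (cmod (F x))\<^sup>2)"

definition AE_constant :: "'a measure \<Rightarrow> ('a \<Rightarrow> complex) \<Rightarrow> bool" where
  "AE_constant M F \<longleftrightarrow> (\<exists>c. AE x in M. F x = c)"

definition comp_mult :: "(nat \<Rightarrow> complex) set" where
  "comp_mult = {f. (\<forall>n\<ge>1. cmod (f n) = 1) \<and> (\<forall>n\<ge>1. \<forall>m\<ge>1. f (n * m) = f n * f m)}"

definition comp_mult_fg :: "(nat \<Rightarrow> complex) set" where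
  "comp_mult_fg = {f \<in> comp_mult. finite (f ` {p. prime p})}"

abbreviation one_fun :: "nat \<Rightarrow> complex" where
  "one_fun \<equiv> (\<lambda>_. 1)"

definition ennreal_sqrt :: "ennreal \<Rightarrow> ennreal" where
  "ennreal_sqrt x = (if x = \<infinity> then \<infinity> else ennreal (sqrt (enn2real x)))"

definition mult_dist :: "(nat \<Rightarrow> complex) \<Rightarrow> (nat \<Rightarrow> complex) \<Rightarrow> ennreal" where
  "mult_dist f g = ennreal_sqrt
     (\<Sum>\<^sub>\<infinity>p\<in>{p. prime p}. ennreal ((1 - Re (f p * cnj (g p))) / real p))"

definition pretentious_class :: "(nat \<Rightarrow> complex) \<Rightarrow> (nat \<Rightarrow> complex) set" where
  "pretentious_class f = {g \<in> comp_mult. mult_dist f g < \<infinity>}"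

definition fun_dist ::
    "'a measure \<Rightarrow> (nat \<Rightarrow> 'a \<Rightarrow> 'a) \<Rightarrow> (nat \<Rightarrow> complex) \<Rightarrow> ('a \<Rightarrow> complex) \<Rightarrow> ennreal" where
  "fun_dist M S f F = ennreal_sqrt
     ((1 / 2) * (\<Sum>\<^sub>\<infinity>p\<in>{p. prime p}.
        ennreal ((L2_nrm M (\<lambda>x. F (S p x) - f p * F x))\<^sup>2 / real p)))"

definition pret_space ::
    "'a measure \<Rightarrow> (nat \<Rightarrow> 'a \<Rightarrow> 'a) \<Rightarrow> (nat \<Rightarrow> complex) \<Rightarrow> ('a \<Rightarrow> complex) set" where
  "pret_space M S f = {F \<in> L2 M. fun_dist M S f F < \<infinity>}"

definition sys_dist :: "'a measure \<Rightarrow> (nat \<Rightarrow> 'a \<Rightarrow> 'a) \<Rightarrow> (nat \<Rightarrow> complex) \<Rightarrow> ennreal" where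
  "sys_dist M S f = (INF F\<in>{F \<in> L2 M. L2_nrm M F = 1}. fun_dist M S f F)"

definition pretentious_eigenfunction ::
    "'a measure \<Rightarrow> (nat \<Rightarrow> 'a \<Rightarrow> 'a) \<Rightarrow> ('a \<Rightarrow> complex) \<Rightarrow> bool" where
  "pretentious_eigenfunction M S F \<longleftrightarrow> (\<exists>f\<in>comp_mult. F \<in> pret_space M S f)"

definition pretentious_spectrum ::
    "'a measure \<Rightarrow> (nat \<Rightarrow> 'a \<Rightarrow> 'a) \<Rightarrow> (nat \<Rightarrow> complex) set" where
  "pretentious_spectrum M S =
     (\<Union>f\<in>{f \<in> comp_mult. sys_dist M S f < \<infinity>}. pretentious_class f)"

definition pretentiously_ergodic :: "'a measure \<Rightarrow> (nat \<Rightarrow> 'a \<Rightarrow> 'a) \<Rightarrow> bool" where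
  "pretentiously_ergodic M S \<longleftrightarrow>
     (\<forall>A\<in>sets M. indicator A \<in> pret_space M S one_fun \<longrightarrow> measure M A = 0 \<or> measure M A = 1)"

definition pretentiously_weak_mixing :: "'a measure \<Rightarrow> (nat \<Rightarrow> 'a \<Rightarrow> 'a) \<Rightarrow> bool" where
  "pretentiously_weak_mixing M S \<longleftrightarrow>
     pretentiously_ergodic (M \<Otimes>\<^sub>M M) (\<lambda>n. map_prod (S n) (S n))"

end

theory Submission
  imports Defs
begin

text \<open>Call a prime \<open>p\<close> big if the reciprocals of the primes \<open>q\<close> with \<open>S q = S p\<close> have infinite sum.
  Since only finitely many maps occur, the small primes have finite reciprocal sum, so a function has
  finite distance to some \<open>f\<close> exactly if it is an eigenfunction of \<open>S p\<close> for every big \<open>p\<close>, the values of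
  \<open>f\<close> at the big primes being pretentiously close to the eigenvalues. Each of (i)--(iv) then says that these
  joint eigenfunctions are constant. For (i) this is the classical weak mixing theorem: an eigenfunction
  \<open>F\<close> yields the invariant function \<open>F x * cnj (F y)\<close>, and conversely a nontrivial invariant set in the
  square yields a nonzero positive Hilbert--Schmidt kernel commuting with the maps and orthogonal to the
  constants. Power iteration produces a projection kernel in the algebra \<open>A\<close> of such kernels; a minimal
  projection \<open>E\<close> satisfies \<open>E A E = \<complex> E\<close>, so the maps act on it by scalars, and its columns \<open>E (-) y\<close> are
  nonconstant joint eigenfunctions.\<close>

subsection \<open>Bounded kernels\<close>

text \<open>Kernels are functions given at every pair of points, bounded, and zero off the carrier,
  not classes modulo null sets. Composition is then an integral at each pair of points, so
  associativity and identities such as \<open>conv M Q Q = Q\<close> are equalities of functions,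
  and the diagonal can carry a trace. The price is that facts obtained in Hilbert-Schmidt norm have
  to be brought back to pointwise ones. The main device for this is to compose with a bounded kernel
  on each side: a small \<open>hs\<close> becomes a uniformly small kernel, and a null kernel
  becomes zero. Commutativity of the maps enters at one place: it keeps \<open>E (T x) y\<close>
  inside the algebra, so that T can be compressed by E to a scalar. The Hilbert-Schmidt norm is what
  makes minimal projections exist: a nonzero projection has squared norm at least 1, which rules out
  endless subdivision.\<close>

definition kernels :: "'a measure \<Rightarrow> ('a \<Rightarrow> 'a \<Rightarrow> complex) set" where
  "kernels M = {K. case_prod K \<in> borel_measurable (M \<Otimes>\<^sub>M M) \<and> (\<exists>C. \<forall>x y. cmod (K x y) \<le> C) \<and>
     (\<forall>x y. x \<notin> space M \<or> y \<notin> space M \<longrightarrow> K x y = 0)}"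

definition conv :: "'a measure \<Rightarrow> ('a \<Rightarrow> 'a \<Rightarrow> complex) \<Rightarrow> ('a \<Rightarrow> 'a \<Rightarrow> complex) \<Rightarrow> 'a \<Rightarrow> 'a \<Rightarrow> complex" where
  "conv M K L = (\<lambda>x y. LINT z|M. K x z * L z y)"

definition star :: "('a \<Rightarrow> 'a \<Rightarrow> complex) \<Rightarrow> 'a \<Rightarrow> 'a \<Rightarrow> complex" where
  "star K = (\<lambda>x y. cnj (K y x))"

definition tr :: "'a measure \<Rightarrow> ('a \<Rightarrow> 'a \<Rightarrow> complex) \<Rightarrow> complex" where
  "tr M K = (LINT x|M. K x x)"

definition hs :: "'a measure \<Rightarrow> ('a \<Rightarrow> 'a \<Rightarrow> complex) \<Rightarrow> real" where
  "hs M K = (LINT x|M. LINT y|M. (cmod (K x y))\<^sup>2)"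

lemma borel_measurable_cnj [measurable (raw)]:
  "f \<in> borel_measurable M \<Longrightarrow> (\<lambda>x. cnj (f x)) \<in> borel_measurable M"
  by (rule measurable_compose[OF _ borel_measurable_continuous_onI]) (auto intro: continuous_intros)

lemma star_star [simp]: "star (star K) = K"
  by (simp add: star_def)

lemma kernelsI:
  assumes "case_prod K \<in> borel_measurable (M \<Otimes>\<^sub>M M)" "\<And>x y. cmod (K x y) \<le> C"
    "\<And>x y. x \<notin> space M \<or> y \<notin> space M \<Longrightarrow> K x y = 0"
  shows "K \<in> kernels M"
  using assms unfolding kernels_def by blast

lemma kernel_bound:
  assumes "K \<in> kernels M"
  obtains C where "C \<ge> 0" "\<And>x y. cmod (K x y) \<le> C"
proof -
  from assms obtain C where C: "\<forall>x y. cmod (K x y) \<le> C" unfolding kernels_def by blast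
  have "0 \<le> C" using C norm_ge_zero order_trans by blast
  then show ?thesis using C that by blast
qed

lemma kernel_outside:
  "K \<in> kernels M \<Longrightarrow> x \<notin> space M \<or> y \<notin> space M \<Longrightarrow> K x y = 0"
  unfolding kernels_def by blast

lemma kernel_measurable: "K \<in> kernels M \<Longrightarrow> case_prod K \<in> borel_measurable (M \<Otimes>\<^sub>M M)"
  unfolding kernels_def by blast

lemma kernel_measurable_comp:
  assumes K: "K \<in> kernels M" and f: "f \<in> N \<rightarrow>\<^sub>M M" and g: "g \<in> N \<rightarrow>\<^sub>M M"
  shows "(\<lambda>w. K (f w) (g w)) \<in> borel_measurable N"
  using measurable_compose[OF measurable_Pair[OF f g] kernel_measurable[OF K]] by simp

lemma kernel_measurable_row:
  assumes K: "K \<in> kernels M" and f: "f \<in> N \<rightarrow>\<^sub>M M"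
  shows "(\<lambda>w. K x (f w)) \<in> borel_measurable N"
proof (cases "x \<in> space M")
  case True
  then show ?thesis by (intro kernel_measurable_comp[OF K] f) simp
next
  case False
  then show ?thesis by (simp add: kernel_outside[OF K])
qed

lemma kernel_measurable_col:
  assumes K: "K \<in> kernels M" and f: "f \<in> N \<rightarrow>\<^sub>M M"
  shows "(\<lambda>w. K (f w) y) \<in> borel_measurable N"
proof (cases "y \<in> space M")
  case True
  then show ?thesis by (intro kernel_measurable_comp[OF K] f) simp
next
  case False
  then show ?thesis by (simp add: kernel_outside[OF K])
qed

lemma kernel_add: 
  assumes K: "K \<in> kernels M" and L: "L \<in> kernels M"
  shows "(\<lambda>x y. K x y + L x y) \<in> kernels M"
proof -
  obtain C where C: "\<And>x y. cmod (K x y) \<le> C" using kernel_bound[OF K] by metis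
  obtain D where D: "\<And>x y. cmod (L x y) \<le> D" using kernel_bound[OF L] by metis
  have "case_prod (\<lambda>x y. K x y + L x y) = (\<lambda>w. case_prod K w + case_prod L w)" by auto
  then show ?thesis
    using kernel_measurable[OF K] kernel_measurable[OF L]
    by (intro kernelsI[where C="C + D"])
      (auto simp: kernel_outside[OF K] kernel_outside[OF L] intro!: norm_triangle_mono C D)
qed

lemma kernel_scale:
  assumes K: "K \<in> kernels M"
  shows "(\<lambda>x y. c * K x y) \<in> kernels M"
proof -
  obtain C where C: "\<And>x y. cmod (K x y) \<le> C" using kernel_bound[OF K] by metis
  have "case_prod (\<lambda>x y. c * K x y) = (\<lambda>w. c * case_prod K w)" by auto
  then show ?thesis
    using kernel_measurable[OF K]
    by (intro kernelsI[where C="cmod c * C"])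
      (auto simp: kernel_outside[OF K] norm_mult intro!: mult_left_mono C)
qed

lemma kernel_diff: 
  assumes K: "K \<in> kernels M" and L: "L \<in> kernels M"
  shows "(\<lambda>x y. K x y - L x y) \<in> kernels M"
  using kernel_add[OF K kernel_scale[OF L, of "-1"]] by simp

lemma kernel_star:
  assumes K: "K \<in> kernels M"
  shows "star K \<in> kernels M"
proof -
  obtain C where C: "\<And>x y. cmod (K x y) \<le> C" using kernel_bound[OF K] by metis
  have "(\<lambda>w. cnj (K (snd w) (fst w))) \<in> borel_measurable (M \<Otimes>\<^sub>M M)"
    by (intro borel_measurable_cnj kernel_measurable_comp[OF K] measurable_fst measurable_snd)
  then show ?thesis
    by (intro kernelsI[where C=C]) (auto simp: star_def split_beta' kernel_outside[OF K] C)
qed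

section \<open>Composition, trace and Hilbert-Schmidt norm of bounded kernels\<close>

context prob_space
begin

lemma integrable_bounded:
  fixes f :: "'a \<Rightarrow> 'b::{banach, second_countable_topology}"
  assumes "f \<in> borel_measurable M" "\<And>x. norm (f x) \<le> C"
  shows "integrable M f"
  using assms by (intro integrable_const_bound[where B=C]) auto

lemma norm_integral_le_const:
  fixes f :: "'a \<Rightarrow> 'b::{banach, second_countable_topology}"
  assumes "\<And>x. norm (f x) \<le> C" and "C \<ge> 0"
  shows "norm (LINT x|M. f x) \<le> C"
proof (cases "integrable M f")
  case True
  have "norm (LINT x|M. f x) \<le> (LINT x|M. norm (f x))" by (rule integral_norm_bound)
  also have "\<dots> \<le> (LINT x|M. C)" using True assms by (intro integral_mono) auto
  finally show ?thesis by (simp add: prob_space)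
next
  case False
  then show ?thesis using assms by (simp add: not_integrable_integral_eq)
qed

lemma integral_square_le_const:
  fixes f :: "'a \<Rightarrow> 'b::real_normed_vector"
  assumes "\<And>x. norm (f x) \<le> C"
  shows "(LINT x|M. (norm (f x))\<^sup>2) \<le> C\<^sup>2"
  using norm_integral_le_const[of "\<lambda>x. (norm (f x))\<^sup>2" "C\<^sup>2"] assms
  by (force intro!: power_mono)

lemma cauchy_schwarz_integral:
  fixes f g :: "'a \<Rightarrow> complex"
  assumes f: "integrable M (\<lambda>x. (cmod (f x))\<^sup>2)" and g: "integrable M (\<lambda>x. (cmod (g x))\<^sup>2)"
    and fm: "f \<in> borel_measurable M" and gm: "g \<in> borel_measurable M"
  shows "integrable M (\<lambda>x. f x * g x)"
    and "(cmod (LINT x|M. f x * g x))\<^sup>2 \<le> (LINT x|M. (cmod (f x))\<^sup>2) * (LINT x|M. (cmod (g x))\<^sup>2)"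
proof -
  note [measurable] = fm gm
  have "norm (f x * g x) \<le> norm ((cmod (f x))\<^sup>2 + (cmod (g x))\<^sup>2)" for x
  proof -
    have "0 \<le> cmod (f x) * cmod (g x)" by simp
    moreover have "2 * (cmod (f x) * cmod (g x)) \<le> (cmod (f x))\<^sup>2 + (cmod (g x))\<^sup>2"
      using sum_squares_bound[of "cmod (f x)" "cmod (g x)"] by simp
    ultimately have "cmod (f x) * cmod (g x) \<le> (cmod (f x))\<^sup>2 + (cmod (g x))\<^sup>2" by linarith
    then show ?thesis by (simp add: norm_mult)
  qed
  then show fg: "integrable M (\<lambda>x. f x * g x)"
    by (intro Bochner_Integration.integrable_bound[OF Bochner_Integration.integrable_add[OF f g]]) auto
  have fg': "integrable M (\<lambda>x. cmod (f x) * cmod (g x))"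
    using integrable_norm[OF fg] by (simp add: norm_mult)
  define a b c where "a = (LINT x|M. (cmod (f x))\<^sup>2)" and "b = (LINT x|M. cmod (f x) * cmod (g x))"
    and "c = (LINT x|M. (cmod (g x))\<^sup>2)"
  have b: "cmod (LINT x|M. f x * g x) \<le> b"
    unfolding b_def using integral_norm_bound[of M "\<lambda>x. f x * g x"] by (simp add: norm_mult)
  have a0: "a \<ge> 0" and c0: "c \<ge> 0" unfolding a_def c_def by (simp_all add: integral_nonneg_AE)
  have q: "0 \<le> s\<^sup>2 * a - 2 * (s * t) * b + t\<^sup>2 * c" for s t :: real
  proof -
    have "0 \<le> (LINT x|M. (s * cmod (f x) - t * cmod (g x))\<^sup>2)" by (simp add: integral_nonneg_AE)
    also have "\<dots> = (LINT x|M. s\<^sup>2 * (cmod (f x))\<^sup>2 - 2 * (s * t) * (cmod (f x) * cmod (g x)) + t\<^sup>2 * (cmod (g x))\<^sup>2)"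
      by (intro Bochner_Integration.integral_cong) (auto simp: power2_eq_square algebra_simps)
    also have "\<dots> = s\<^sup>2 * a - 2 * (s * t) * b + t\<^sup>2 * c"
      unfolding a_def b_def c_def using f g fg' by simp
    finally show ?thesis .
  qed
  have "b\<^sup>2 \<le> a * c"
  proof (cases "c = 0")
    case True
    have "b = 0"
    proof (rule ccontr)
      assume "b \<noteq> 0"
      \<comment> \<open>With c = 0 this t turns the quadratic form into a - (a + 1) = -1.\<close>
      then show False using q[of 1 "(a + 1) / (2 * b)"] True a0 by (simp add: field_simps)
    qed
    then show ?thesis using True by simp
  next
    case False
    then have "c > 0" using c0 by simp
    \<comment> \<open>The ratio t/s = b/c minimises the form; taking s = c and t = b avoids the
      division.\<close>
    have "0 \<le> c * (c * a - b\<^sup>2)" using q[of c b] by (simp add: power2_eq_square algebra_simps)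
    then have "0 \<le> c * a - b\<^sup>2" using \<open>c > 0\<close> by (simp add: zero_le_mult_iff)
    then show ?thesis by (simp add: mult.commute)
  qed
  moreover have "(cmod (LINT x|M. f x * g x))\<^sup>2 \<le> b\<^sup>2" using b by (intro power_mono) auto
  ultimately show "(cmod (LINT x|M. f x * g x))\<^sup>2 \<le> (LINT x|M. (cmod (f x))\<^sup>2) * (LINT x|M. (cmod (g x))\<^sup>2)"
    unfolding a_def c_def by linarith
qed

lemma kernel_row_square_integrable:
  assumes K: "K \<in> kernels M" 
  shows "integrable M (\<lambda>y. (cmod (K x y))\<^sup>2)" "(\<lambda>y. K x y) \<in> borel_measurable M"
proof -
  obtain C where C: "\<And>x y. cmod (K x y) \<le> C" using kernel_bound[OF K] by metis
  show [measurable]: "(\<lambda>y. K x y) \<in> borel_measurable M" by (intro kernel_measurable_row[OF K]) simp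
  show "integrable M (\<lambda>y. (cmod (K x y))\<^sup>2)"
    by (rule integrable_bounded[where C="C\<^sup>2"]) (auto intro!: power_mono C)
qed

lemma kernel_mult_integrable:
  assumes K: "K \<in> kernels M" and L: "L \<in> kernels M"
  shows "integrable M (\<lambda>z. K x z * L z y)"
  using kernel_row_square_integrable[OF K, of x]
    kernel_row_square_integrable(1)[OF kernel_star[OF L], of y] kernel_measurable_col[OF L, of "\<lambda>x. x" M y]
  by (intro cauchy_schwarz_integral(1)) (auto simp: star_def)

lemma kernel_conv [intro]:
  assumes K: "K \<in> kernels M" and L: "L \<in> kernels M"
  shows "conv M K L \<in> kernels M"
proof -
  obtain C where C: "C \<ge> 0" "\<And>x y. cmod (K x y) \<le> C" using kernel_bound[OF K] by metis
  obtain D where D: "D \<ge> 0" "\<And>x y. cmod (L x y) \<le> D" using kernel_bound[OF L] by metis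
  have 1: "case_prod (\<lambda>w z. K (fst w) z * L z (snd w)) \<in> borel_measurable ((M \<Otimes>\<^sub>M M) \<Otimes>\<^sub>M M)"
    unfolding split_beta' by (intro borel_measurable_times kernel_measurable_comp[OF K] kernel_measurable_comp[OF L]) auto
  have "case_prod (conv M K L) = (\<lambda>w. LINT z|M. K (fst w) z * L z (snd w))"
    by (auto simp: conv_def)
  then have "case_prod (conv M K L) \<in> borel_measurable (M \<Otimes>\<^sub>M M)"
    using borel_measurable_lebesgue_integral[OF 1] by simp
  moreover have "cmod (conv M K L x y) \<le> C * D" for x y
    unfolding conv_def using C D by (intro norm_integral_le_const) (auto simp: norm_mult intro!: mult_mono)
  ultimately show ?thesis
    by (rule kernelsI) (auto simp: conv_def kernel_outside[OF K] kernel_outside[OF L])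
qed

lemma fubini_bounded:
  fixes f :: "'a \<Rightarrow> 'a \<Rightarrow> 'b::{banach, second_countable_topology}"
  assumes "case_prod f \<in> borel_measurable (M \<Otimes>\<^sub>M M)" "\<And>x y. norm (f x y) \<le> C"
  shows "(LINT x|M. LINT y|M. f x y) = (LINT y|M. LINT x|M. f x y)"
    and "(LINT x|M. LINT y|M. f x y) = (LINT w|(M \<Otimes>\<^sub>M M). case_prod f w)"
proof -
  interpret P: pair_prob_space M M ..
  have i: "integrable (M \<Otimes>\<^sub>M M) (case_prod f)"
    using assms by (intro P.integrable_bounded[where C=C]) auto
  show "(LINT x|M. LINT y|M. f x y) = (LINT y|M. LINT x|M. f x y)"
    using P.Fubini_integral[OF i] by simp
  show "(LINT x|M. LINT y|M. f x y) = (LINT w|(M \<Otimes>\<^sub>M M). case_prod f w)"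
    using P.integral_fst[OF i] by simp
qed

text \<open>Fubini at fixed x and y. The triple product is bounded, hence integrable for every such
  pair, and no exceptional null set appears.\<close>

lemma conv_assoc:
  assumes K: "K \<in> kernels M" and L: "L \<in> kernels M" and N: "N \<in> kernels M"
  shows "conv M (conv M K L) N = conv M K (conv M L N)"
proof (intro ext)
  fix x y
  obtain C where C: "C \<ge> 0" "\<And>x y. cmod (K x y) \<le> C" using kernel_bound[OF K] by metis
  obtain D where D: "D \<ge> 0" "\<And>x y. cmod (L x y) \<le> D" using kernel_bound[OF L] by metis
  obtain E where E: "E \<ge> 0" "\<And>x y. cmod (N x y) \<le> E" using kernel_bound[OF N] by metis
  have m: "(\<lambda>(z, w). K x w * L w z * N z y) \<in> borel_measurable (M \<Otimes>\<^sub>M M)"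
    unfolding split_beta'
    by (intro borel_measurable_times kernel_measurable_row[OF K] kernel_measurable_comp[OF L] kernel_measurable_col[OF N]) auto
  have "conv M (conv M K L) N x y = (LINT z|M. LINT w|M. K x w * L w z * N z y)"
    unfolding conv_def
    by (intro Bochner_Integration.integral_cong refl integral_mult_left_zero[symmetric])
  also have "\<dots> = (LINT w|M. LINT z|M. K x w * L w z * N z y)"
    by (rule fubini_bounded(1)[OF m, where C="C * D * E"])
      (use C D E in \<open>auto simp: norm_mult intro!: mult_mono\<close>)
  also have "\<dots> = conv M K (conv M L N) x y"
    unfolding conv_def mult.assoc
    by (intro Bochner_Integration.integral_cong refl integral_mult_right_zero)
  finally show "conv M (conv M K L) N x y = conv M K (conv M L N) x y" .
qed

lemma conv_add_left:
  assumes "K \<in> kernels M" "L \<in> kernels M" "N \<in> kernels M"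
  shows "conv M (\<lambda>x y. K x y + L x y) N = (\<lambda>x y. conv M K N x y + conv M L N x y)"
  using assms by (auto simp: conv_def distrib_right intro!: ext Bochner_Integration.integral_add kernel_mult_integrable)

lemma conv_add_right:
  assumes "K \<in> kernels M" "L \<in> kernels M" "N \<in> kernels M"
  shows "conv M N (\<lambda>x y. K x y + L x y) = (\<lambda>x y. conv M N K x y + conv M N L x y)"
  using assms by (auto simp: conv_def distrib_left intro!: ext Bochner_Integration.integral_add kernel_mult_integrable)

lemma conv_diff_left:
  assumes "K \<in> kernels M" "L \<in> kernels M" "N \<in> kernels M"
  shows "conv M (\<lambda>x y. K x y - L x y) N = (\<lambda>x y. conv M K N x y - conv M L N x y)"
  using assms by (auto simp: conv_def left_diff_distrib intro!: ext Bochner_Integration.integral_diff kernel_mult_integrable)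

lemma conv_diff_right:
  assumes "K \<in> kernels M" "L \<in> kernels M" "N \<in> kernels M"
  shows "conv M N (\<lambda>x y. K x y - L x y) = (\<lambda>x y. conv M N K x y - conv M N L x y)"
  using assms by (auto simp: conv_def right_diff_distrib intro!: ext Bochner_Integration.integral_diff kernel_mult_integrable)

lemma conv_scale_left: "conv M (\<lambda>x y. c * K x y) N = (\<lambda>x y. c * conv M K N x y)"
  by (auto simp: conv_def mult.assoc intro!: ext)

lemma conv_scale_right: "conv M N (\<lambda>x y. c * K x y) = (\<lambda>x y. c * conv M N K x y)"
  by (auto simp: conv_def mult.left_commute intro!: ext)

lemma star_conv: "star (conv M K L) = conv M (star L) (star K)"
proof (intro ext)
  fix x y
  have "star (conv M K L) x y = (LINT z|M. cnj (K y z * L z x))"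
    unfolding star_def conv_def by (simp del: complex_cnj_mult)
  then show "star (conv M K L) x y = conv M (star L) (star K) x y"
    by (simp add: star_def conv_def mult.commute)
qed

lemma tr_star: "tr M (star K) = cnj (tr M K)"
  by (simp add: tr_def star_def)

lemma kernel_diag_integrable:
  assumes K: "K \<in> kernels M"
  shows "integrable M (\<lambda>x. K x x)"
proof -
  obtain C where C: "\<And>x y. cmod (K x y) \<le> C" using kernel_bound[OF K] by metis
  then show ?thesis by (intro integrable_bounded[where C=C] kernel_measurable_comp[OF K]) auto
qed

lemma tr_diff: "K \<in> kernels M \<Longrightarrow> L \<in> kernels M \<Longrightarrow> tr M (\<lambda>x y. K x y - L x y) = tr M K - tr M L"
  unfolding tr_def by (intro Bochner_Integration.integral_diff kernel_diag_integrable)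

lemma tr_scale: "tr M (\<lambda>x y. c * K x y) = c * tr M K"
  by (simp add: tr_def)

lemma tr_commute:
  assumes K: "K \<in> kernels M" and L: "L \<in> kernels M"
  shows "tr M (conv M K L) = tr M (conv M L K)"
proof -
  obtain C where C: "C \<ge> 0" "\<And>x y. cmod (K x y) \<le> C" using kernel_bound[OF K] by metis
  obtain D where D: "D \<ge> 0" "\<And>x y. cmod (L x y) \<le> D" using kernel_bound[OF L] by metis
  have m: "(\<lambda>(x, z). K x z * L z x) \<in> borel_measurable (M \<Otimes>\<^sub>M M)"
    unfolding split_beta'
    by (intro borel_measurable_times kernel_measurable_comp[OF K] kernel_measurable_comp[OF L]) auto
  have "(LINT x|M. LINT z|M. K x z * L z x) = (LINT z|M. LINT x|M. K x z * L z x)"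
    by (rule fubini_bounded(1)[OF m, where C="C * D"])
      (use C D in \<open>auto simp: norm_mult intro!: mult_mono\<close>)
  then show ?thesis by (simp add: tr_def conv_def mult.commute)
qed

lemma kernel_square_measurable:
  assumes K: "K \<in> kernels M"
  shows "(\<lambda>(x, y). (cmod (K x y))\<^sup>2) \<in> borel_measurable (M \<Otimes>\<^sub>M M)"
proof -
  have "(\<lambda>(x, y). (cmod (K x y))\<^sup>2) = (\<lambda>w. (cmod (case_prod K w))\<^sup>2)" by auto
  then show ?thesis using kernel_measurable[OF K] by simp
qed

lemma hs_eq_pair:
  assumes K: "K \<in> kernels M"
  shows "hs M K = (LINT w|(M \<Otimes>\<^sub>M M). (cmod (case_prod K w))\<^sup>2)"
proof -
  obtain C where C: "\<And>x y. cmod (K x y) \<le> C" using kernel_bound[OF K] by metis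
  have "hs M K = (LINT w|(M \<Otimes>\<^sub>M M). case_prod (\<lambda>x y. (cmod (K x y))\<^sup>2) w)"
    unfolding hs_def
    by (rule fubini_bounded(2)[OF kernel_square_measurable[OF K], where C="C\<^sup>2"]) (auto intro!: power_mono C)
  then show ?thesis by (simp add: split_beta')
qed

lemma kernel_square_integrable_pair:
  assumes K: "K \<in> kernels M"
  shows "integrable (M \<Otimes>\<^sub>M M) (\<lambda>w. (cmod (case_prod K w))\<^sup>2)"
proof -
  interpret P: pair_prob_space M M ..
  obtain C where C: "\<And>x y. cmod (K x y) \<le> C" using kernel_bound[OF K] by metis
  then show ?thesis using kernel_square_measurable[OF K]
    by (intro P.integrable_bounded[where C="C\<^sup>2"]) (auto simp: split_beta' intro!: power_mono C)
qed

lemma hs_nonneg: "hs M K \<ge> 0"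
  unfolding hs_def by (intro integral_nonneg_AE AE_I2) simp

lemma hs_star:
  assumes K: "K \<in> kernels M"
  shows "hs M (star K) = hs M K"
proof -
  obtain C where C: "\<And>x y. cmod (K x y) \<le> C" using kernel_bound[OF K] by metis
  show ?thesis unfolding hs_def star_def complex_mod_cnj
    by (rule fubini_bounded(1)[symmetric, OF kernel_square_measurable[OF K], where C="C\<^sup>2"]) (auto intro!: power_mono C)
qed

text \<open>The Hilbert-Schmidt inner product of K and L is the trace of K composed with
  \<open>star L\<close>; this is its diagonal case. It is what allows norms of powers to be read as
  traces of higher powers.\<close>

lemma tr_conv_star: "tr M (conv M K (star K)) = of_real (hs M K)"
proof -
  have "tr M (conv M K (star K)) = (LINT x|M. LINT y|M. of_real ((cmod (K x y))\<^sup>2))"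
    unfolding tr_def conv_def star_def complex_norm_square ..
  then show ?thesis by (simp add: hs_def del: of_real_power)
qed

text \<open>Cauchy-Schwarz on the product space for K paired with \<open>star L\<close>. Applied to
  powers of one kernel it yields log-convexity of their norms.\<close>

lemma tr_conv_bound:
  assumes K: "K \<in> kernels M" and L: "L \<in> kernels M"
  shows "(cmod (tr M (conv M K L)))\<^sup>2 \<le> hs M K * hs M L"
proof -
  interpret P: pair_prob_space M M ..
  obtain C where C: "C \<ge> 0" "\<And>x y. cmod (K x y) \<le> C" using kernel_bound[OF K] by metis
  obtain D where D: "D \<ge> 0" "\<And>x y. cmod (L x y) \<le> D" using kernel_bound[OF L] by metis
  have m: "(\<lambda>(x, z). K x z * L z x) \<in> borel_measurable (M \<Otimes>\<^sub>M M)"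
    unfolding split_beta'
    by (intro borel_measurable_times kernel_measurable_comp[OF K] kernel_measurable_comp[OF L]) auto
  have "tr M (conv M K L) = (LINT w|(M \<Otimes>\<^sub>M M). (\<lambda>(x, z). K x z * L z x) w)"
    unfolding tr_def conv_def
    by (rule fubini_bounded(2)[OF m, where C="C * D"]) (use C D in \<open>auto simp: norm_mult intro!: mult_mono\<close>)
  also have "\<dots> = (LINT w|(M \<Otimes>\<^sub>M M). case_prod K w * cnj (case_prod (star L) w))"
    by (intro Bochner_Integration.integral_cong) (auto simp: star_def)
  finally have eq: "tr M (conv M K L) = \<dots>" .
  have "(cmod (LINT w|(M \<Otimes>\<^sub>M M). case_prod K w * cnj (case_prod (star L) w)))\<^sup>2 \<le> hs M K * hs M (star L)"
    using P.cauchy_schwarz_integral(2)[of "case_prod K" "\<lambda>w. cnj (case_prod (star L) w)"]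
      kernel_square_integrable_pair[OF K] kernel_square_integrable_pair[OF kernel_star[OF L]]
      kernel_measurable[OF K] kernel_measurable[OF kernel_star[OF L]]
    by (simp add: hs_eq_pair K kernel_star L)
  then show ?thesis unfolding eq hs_star[OF L] .
qed

lemma conv_entry_bound:
  assumes K: "K \<in> kernels M" and L: "L \<in> kernels M"
  shows "(cmod (conv M K L x y))\<^sup>2 \<le> (LINT z|M. (cmod (K x z))\<^sup>2) * (LINT z|M. (cmod (L z y))\<^sup>2)"
  unfolding conv_def
  using kernel_row_square_integrable[OF K, of x]
    kernel_row_square_integrable(1)[OF kernel_star[OF L], of y] kernel_measurable_col[OF L, of "\<lambda>x. x" M y]
  by (intro cauchy_schwarz_integral(2)) (auto simp: star_def)

text \<open>An entry of the product is at most (row norm of K at x) times (column norm of L at y),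
  and the integral of such a product over both variables factorises. For an idempotent this forces
  \<open>hs\<close> to be 0 or at least 1.\<close>

lemma hs_conv:
  assumes K: "K \<in> kernels M" and L: "L \<in> kernels M"
  shows "hs M (conv M K L) \<le> hs M K * hs M L"
proof -
  obtain C where C: "C \<ge> 0" "\<And>x y. cmod (K x y) \<le> C" using kernel_bound[OF K] by metis
  obtain D where D: "D \<ge> 0" "\<And>x y. cmod (L x y) \<le> D" using kernel_bound[OF L] by metis
  define a where "a x = (LINT z|M. (cmod (K x z))\<^sup>2)" for x
  define b where "b y = (LINT z|M. (cmod (L z y))\<^sup>2)" for y
  have a[measurable]: "a \<in> borel_measurable M"
    unfolding a_def by (rule borel_measurable_lebesgue_integral[OF kernel_square_measurable[OF K]])
  have b: "b = (\<lambda>y. LINT z|M. (cmod (star L y z))\<^sup>2)" unfolding b_def star_def by simp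
  have [measurable]: "b \<in> borel_measurable M"
    unfolding b by (rule borel_measurable_lebesgue_integral[OF kernel_square_measurable[OF kernel_star[OF L]]])
  have ab: "norm (a x) \<le> C\<^sup>2" for x unfolding a_def
    using C by (intro norm_integral_le_const) (auto intro!: power_mono)
  have bb: "norm (b x) \<le> D\<^sup>2" for x unfolding b_def
    using D by (intro norm_integral_le_const) (auto intro!: power_mono)
  have ai: "integrable M a" using ab by (intro integrable_bounded[where C="C\<^sup>2"]) auto
  have bi: "integrable M b" using bb by (intro integrable_bounded[where C="D\<^sup>2"]) auto
  have c: "conv M K L \<in> kernels M" using K L by (rule kernel_conv)
  have "hs M (conv M K L) \<le> (LINT x|M. LINT y|M. a x * b y)"
    unfolding hs_def
  proof (intro integral_mono)
    obtain E where E: "E \<ge> 0" "\<And>x y. cmod (conv M K L x y) \<le> E" using kernel_bound[OF c] by metis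
    show "integrable M (\<lambda>x. LINT y|M. (cmod (conv M K L x y))\<^sup>2)"
      by (rule integrable_bounded[where C="E\<^sup>2"], rule borel_measurable_lebesgue_integral[OF kernel_square_measurable[OF c]])
       (use E in \<open>auto simp: integral_nonneg_AE intro!: integral_square_le_const\<close>)
    show "integrable M (\<lambda>x. LINT y|M. a x * b y)" using ai by simp
    show "integrable M (\<lambda>y. (cmod (conv M K L x y))\<^sup>2)" for x
      using kernel_row_square_integrable[OF c] by simp
    show "integrable M (\<lambda>y. a x * b y)" for x using bi by simp
    show "(cmod (conv M K L x y))\<^sup>2 \<le> a x * b y" for x y 
      unfolding a_def b_def by (rule conv_entry_bound[OF K L])
  qed
  also have "\<dots> = (LINT x|M. a x) * (LINT y|M. b y)" by simp
  also have "(LINT x|M. a x) = hs M K" by (simp add: a_def hs_def)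
  also have "(LINT y|M. b y) = hs M L" using hs_star[OF L] by (simp add: b hs_def)
  finally show ?thesis .
qed

text \<open>For iterates of one self-adjoint kernel every term on the right is the trace of a
  further iterate, so convergence of the traces makes the iterates a Cauchy sequence.\<close>

lemma hs_diff:
  assumes K: "K \<in> kernels M" and L: "L \<in> kernels M"
  shows "hs M (\<lambda>x y. K x y - L x y) = hs M K + hs M L - 2 * Re (tr M (conv M K (star L)))"
proof -
  let ?D = "\<lambda>x y. K x y - L x y"
  note ks = kernel_star[OF K] kernel_star[OF L]
  have s: "star ?D = (\<lambda>x y. star K x y - star L x y)" by (auto simp: star_def)
  have "conv M ?D (star ?D) = (\<lambda>x y. (conv M K (star K) x y - conv M L (star K) x y) - (conv M K (star L) x y - conv M L (star L) x y))"
    unfolding s using K L ks by (simp add: conv_diff_right conv_diff_left kernel_diff)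
  then have "tr M (conv M ?D (star ?D)) = (tr M (conv M K (star K)) - tr M (conv M L (star K))) - (tr M (conv M K (star L)) - tr M (conv M L (star L)))"
    using K L ks by (simp add: tr_diff kernel_diff kernel_conv)
  moreover have "tr M (conv M L (star K)) = cnj (tr M (conv M K (star L)))"
    by (simp add: star_conv flip: tr_star)
  ultimately have "of_real (hs M ?D) = of_real (hs M K) + of_real (hs M L) - (tr M (conv M K (star L)) + cnj (tr M (conv M K (star L))))"
    by (simp add: tr_conv_star)
  then have "Re (of_real (hs M ?D)) = Re (of_real (hs M K) + of_real (hs M L) - (tr M (conv M K (star L)) + cnj (tr M (conv M K (star L)))))"
    by (rule arg_cong)
  then show ?thesis by simp
qed

text \<open>Two applications of Cauchy-Schwarz: the bounded columns of L turn the norm of D into a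
  bound on the columns of D L, and the bounded rows of K turn that into a bound on each entry. This
  upgrades Hilbert-Schmidt convergence to uniform convergence.\<close>

lemma sandwich_bound:
  assumes K: "K \<in> kernels M" and D: "D \<in> kernels M" and L: "L \<in> kernels M"
    and A: "A \<ge> 0" "\<And>x y. cmod (K x y) \<le> A" and B: "B \<ge> 0" "\<And>x y. cmod (L x y) \<le> B"
  shows "cmod (conv M K (conv M D L) x y) \<le> A * B * sqrt (hs M D)"
proof -
  have DL: "conv M D L \<in> kernels M" using D L by (rule kernel_conv)
  have K2: "(LINT z|M. (cmod (K u z))\<^sup>2) \<le> A\<^sup>2" for u
    using A by (intro integral_square_le_const)
  have L2: "(LINT z|M. (cmod (L z v))\<^sup>2) \<le> B\<^sup>2" for v
    using B by (intro integral_square_le_const)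
  define d where "d z = (LINT w|M. (cmod (D z w))\<^sup>2)" for z
  have d0: "d z \<ge> 0" for z unfolding d_def by (intro integral_nonneg_AE AE_I2) simp
  obtain C where C: "C \<ge> 0" "\<And>x y. cmod (D x y) \<le> C" using kernel_bound[OF D] by metis
  have di: "integrable M d" unfolding d_def
    by (rule integrable_bounded[where C="C\<^sup>2"], rule borel_measurable_lebesgue_integral[OF kernel_square_measurable[OF D]])
       (use C in \<open>auto simp: integral_nonneg_AE intro!: integral_square_le_const\<close>)
  have "(cmod (conv M D L z y))\<^sup>2 \<le> d z * B\<^sup>2" for z
    using conv_entry_bound[OF D L, of z y] mult_left_mono[OF L2 d0, of z y] unfolding d_def by linarith
  then have "(LINT z|M. (cmod (conv M D L z y))\<^sup>2) \<le> (LINT z|M. d z * B\<^sup>2)"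
    using kernel_row_square_integrable[OF kernel_star[OF DL], of y] di
    by (intro integral_mono) (auto simp: star_def)
  also have "\<dots> = hs M D * B\<^sup>2" by (simp add: hs_def d_def)
  finally have 1: "(LINT z|M. (cmod (conv M D L z y))\<^sup>2) \<le> hs M D * B\<^sup>2" .
  have "(cmod (conv M K (conv M D L) x y))\<^sup>2 \<le> (LINT z|M. (cmod (K x z))\<^sup>2) * (LINT z|M. (cmod (conv M D L z y))\<^sup>2)"
    by (rule conv_entry_bound[OF K DL])
  also have "\<dots> \<le> A\<^sup>2 * (hs M D * B\<^sup>2)"
    using K2 1 by (intro mult_mono) (auto intro!: integral_nonneg_AE AE_I2)
  also have "\<dots> = (A * B * sqrt (hs M D))\<^sup>2" by (simp add: power_mult_distrib hs_nonneg)
  finally show ?thesis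
    by (rule power2_le_imp_le) (intro mult_nonneg_nonneg A B real_sqrt_ge_zero hs_nonneg)
qed

lemma hs_eq_0_iff:
  assumes K: "K \<in> kernels M"
  shows "hs M K = 0 \<longleftrightarrow> (AE w in M \<Otimes>\<^sub>M M. case_prod K w = 0)"
  using integral_nonneg_eq_0_iff_AE[OF kernel_square_integrable_pair[OF K]]
  by (simp add: hs_eq_pair[OF K])

end

subsection \<open>Minimal projections in algebras of kernels\<close>

text \<open>For a self-adjoint H, \<open>s n\<close> will be the sum of the (n+1)-st powers of the
  eigenvalues of H^2. Then l is the largest of these eigenvalues, obtained as the limit of the
  ratios of consecutive terms, and b is its multiplicity. Log-convexity makes the ratios increase;
  submultiplicativity bounds them by \<open>s 0\<close>.\<close>

lemma log_convex_submultiplicative_limit: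
  fixes s :: "nat \<Rightarrow> real"
  assumes pos: "\<And>n. s n > 0" and log_convex: "\<And>n. (s (Suc n))\<^sup>2 \<le> s n * s (Suc (Suc n))"
    and submult: "\<And>n m. s (n + m + 1) \<le> s n * s m"
  obtains l b where "l > 0" "b \<ge> 1" "decseq (\<lambda>n. s n / l ^ Suc n)" "(\<lambda>n. s n / l ^ Suc n) \<longlonglongrightarrow> b"
proof -
  define r where "r n = s (Suc n) / s n" for n
  have r_pos: "r n > 0" for n unfolding r_def using pos by simp
  have "r n \<le> r (Suc n)" for n
    unfolding r_def using log_convex[of n] pos by (simp add: divide_simps power2_eq_square mult.commute)
  then have inc: "incseq r" by (rule incseq_SucI)
  have "r n \<le> s 0" for n using submult[of n 0] pos[of n] by (simp add: r_def divide_simps mult.commute)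
  then obtain l where l: "r \<longlonglongrightarrow> l" and le: "\<And>n. r n \<le> l"
    using incseq_convergent[OF inc] by metis
  have l_pos: "l > 0" using r_pos[of 0] le[of 0] by linarith
  have step: "s (Suc n) \<le> l * s n" for n
    using le[of n] pos[of n] by (simp add: r_def divide_simps mult.commute)
  define b where "b n = s n / l ^ Suc n" for n
  have "b (Suc n) \<le> b n" for n
  proof -
    have "s (Suc n) / l ^ Suc (Suc n) \<le> (l * s n) / l ^ Suc (Suc n)"
      using step l_pos by (intro divide_right_mono) auto
    then show ?thesis using l_pos by (simp add: b_def)
  qed
  then have dec: "decseq b" by (rule decseq_SucI)
  \<comment> \<open>The ratios increase, so each of the k factors leading from \<open>s n\<close> to
    \<open>s (n + k)\<close> is at least \<open>r n\<close>.\<close>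
  have growth: "r n ^ k * s n \<le> s (n + k)" for n k
  proof (induction k)
    case (Suc k)
    have "r n ^ Suc k * s n \<le> r n * s (n + k)"
      using mult_left_mono[OF Suc, of "r n"] r_pos[of n] by (simp add: mult.assoc less_imp_le)
    also have "\<dots> \<le> r (n + k) * s (n + k)"
      using incseqD[OF inc, of n "n + k"] pos[of "n + k"] by (intro mult_right_mono) auto
    also have "\<dots> = s (n + Suc k)" using pos[of "n + k"] by (simp add: r_def)
    finally show ?case .
  qed simp
  have "b m \<ge> 1" for m
  proof -
    have "r n ^ Suc m \<le> s m" for n
    proof -
      \<comment> \<open>Growth from n meets submultiplicativity at n + m + 1. The common factor
        \<open>s n\<close> cancels, after which n tends to infinity and \<open>r n\<close> becomes
        l.\<close>
      have "r n ^ Suc m * s n \<le> s m * s n"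
        using growth[of n "Suc m"] submult[of n m] by (simp add: mult.commute)
      then show ?thesis using pos[of n] by (simp del: power_Suc)
    qed
    then have "l ^ Suc m \<le> s m"
      by (intro LIMSEQ_le_const2[OF tendsto_power[OF l]]) blast
    then show ?thesis using l_pos by (simp add: b_def divide_simps)
  qed
  moreover from this obtain c where "b \<longlonglongrightarrow> c"
    using decseq_convergent[OF dec, of 1] by metis
  moreover from calculation have "c \<ge> 1" by (intro LIMSEQ_le_const) auto
  ultimately show thesis using that[OF l_pos] dec unfolding b_def by blast
qed

context prob_space
begin

lemma kernel_uniform_limit:
  assumes k: "\<And>n. k n \<in> kernels M"
    and lim: "uniform_limit UNIV (\<lambda>n. case_prod (k n)) (case_prod K) sequentially"
  shows "K \<in> kernels M"
proof -
  have ptw: "(\<lambda>n. k n x y) \<longlonglongrightarrow> K x y" for x y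
    using tendsto_uniform_limitI[OF lim, of "(x, y)"] by simp
  obtain N where N: "\<And>w. dist (case_prod (k N) w) (case_prod K w) < 1"
    using uniform_limitD[OF lim, of 1] unfolding eventually_sequentially by auto
  obtain C where C: "\<And>x y. cmod (k N x y) \<le> C" using kernel_bound[OF k] by metis
  have "cmod (K x y) \<le> C + 1" for x y
    using N[of "(x, y)"] C[of x y] norm_triangle_ineq2[of "K x y" "k N x y"]
    by (simp add: dist_norm norm_minus_commute)
  moreover have "case_prod K \<in> borel_measurable (M \<Otimes>\<^sub>M M)"
    by (rule borel_measurable_LIMSEQ_metric[where f="\<lambda>n. case_prod (k n)"])
      (auto simp: ptw kernel_measurable[OF k] split: prod.split)
  moreover have "K x y = 0" if "x \<notin> space M \<or> y \<notin> space M" for x y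
    using LIMSEQ_unique[OF ptw[of x y], of 0] kernel_outside[OF k that] by simp
  ultimately show ?thesis by (intro kernelsI) auto
qed

text \<open>Removes null-set defects: a kernel that equals its own composition with itself on both
  sides is zero at every point as soon as it is zero almost everywhere.\<close>

lemma sandwich_null:
  assumes "K \<in> kernels M" "D \<in> kernels M" "L \<in> kernels M" "hs M D = 0"
  shows "conv M K (conv M D L) = (\<lambda>x y. 0)"
proof (intro ext)
  fix x y
  obtain A where A: "A \<ge> 0" "\<And>x y. cmod (K x y) \<le> A" using kernel_bound[OF assms(1)] by metis
  obtain B where B: "B \<ge> 0" "\<And>x y. cmod (L x y) \<le> B" using kernel_bound[OF assms(3)] by metis
  show "conv M K (conv M D L) x y = 0" using sandwich_bound[OF assms(1-3) A B, of x y] assms(4) by simp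
qed

lemma conv_tendsto:
  assumes k: "\<And>n. k n \<in> kernels M" and l: "\<And>n. l n \<in> kernels M"
    and C: "C \<ge> 0" "\<And>n x y. cmod (k n x y) \<le> C" and D: "\<And>n x y. cmod (l n x y) \<le> D"
    and kK: "\<And>x y. (\<lambda>n. k n x y) \<longlonglongrightarrow> K x y" and lL: "\<And>x y. (\<lambda>n. l n x y) \<longlonglongrightarrow> L x y"
    and K: "K \<in> kernels M" and L: "L \<in> kernels M"
  shows "(\<lambda>n. conv M (k n) (l n) x y) \<longlonglongrightarrow> conv M K L x y"
  unfolding conv_def
proof (rule integral_dominated_convergence[where w="\<lambda>_. C * D"])
  show "(\<lambda>z. K x z * L z y) \<in> borel_measurable M"
    using kernel_mult_integrable[OF K L] by (rule borel_measurable_integrable)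
  show "(\<lambda>z. k n x z * l n z y) \<in> borel_measurable M" for n
    using kernel_mult_integrable[OF k l] by (rule borel_measurable_integrable)
  show "AE z in M. (\<lambda>n. k n x z * l n z y) \<longlonglongrightarrow> K x z * L z y"
    by (intro AE_I2 tendsto_mult kK lL)
  show "AE z in M. norm (k n x z * l n z y) \<le> C * D" for n
    unfolding norm_mult by (intro AE_I2 mult_mono C D) auto
qed simp

lemma tr_tendsto:
  assumes k: "\<And>n. k n \<in> kernels M" and C: "\<And>n x y. cmod (k n x y) \<le> C" 
    and kK: "\<And>x y. (\<lambda>n. k n x y) \<longlonglongrightarrow> K x y" and K: "K \<in> kernels M"
  shows "(\<lambda>n. tr M (k n)) \<longlonglongrightarrow> tr M K"
  unfolding tr_def
proof (rule integral_dominated_convergence[where w="\<lambda>_. C"])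
  show "(\<lambda>x. K x x) \<in> borel_measurable M"
    using kernel_diag_integrable[OF K] by (rule borel_measurable_integrable)
  show "(\<lambda>x. k n x x) \<in> borel_measurable M" for n
    using kernel_diag_integrable[OF k] by (rule borel_measurable_integrable)
qed (auto simp: kK C)

end

text \<open>No unit is available, since the identity operator has no bounded kernel in general.
  Closure is under uniform limits, the mode of convergence that power iteration delivers and one
  that preserves boundedness.\<close>

locale kernel_algebra = prob_space M for M :: "'a measure" +
  fixes \<A> :: "('a \<Rightarrow> 'a \<Rightarrow> complex) set"
  assumes algebra_kernels: "\<A> \<subseteq> kernels M"
    and algebra_add: "K \<in> \<A> \<Longrightarrow> L \<in> \<A> \<Longrightarrow> (\<lambda>x y. K x y + L x y) \<in> \<A>"
    and algebra_scale: "K \<in> \<A> \<Longrightarrow> (\<lambda>x y. c * K x y) \<in> \<A>"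
    and algebra_conv: "K \<in> \<A> \<Longrightarrow> L \<in> \<A> \<Longrightarrow> conv M K L \<in> \<A>"
    and algebra_star: "K \<in> \<A> \<Longrightarrow> star K \<in> \<A>"
    and algebra_limit: "(\<And>n. k n \<in> \<A>) \<Longrightarrow>
      uniform_limit UNIV (\<lambda>n. case_prod (k n)) (case_prod K) sequentially \<Longrightarrow> K \<in> \<A>"
begin

definition projection :: "('a \<Rightarrow> 'a \<Rightarrow> complex) \<Rightarrow> bool" where
  "projection Q \<longleftrightarrow> Q \<in> \<A> \<and> star Q = Q \<and> conv M Q Q = Q"

lemma kernel: "K \<in> \<A> \<Longrightarrow> K \<in> kernels M"
  using algebra_kernels by blast

lemma algebra_diff: "K \<in> \<A> \<Longrightarrow> L \<in> \<A> \<Longrightarrow> (\<lambda>x y. K x y - L x y) \<in> \<A>"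
  using algebra_add[of K "\<lambda>x y. -1 * L x y"] algebra_scale[of L "-1"] by simp

text \<open>Power iteration: after rescaling, the powers of the positive kernel \<open>H\<^sup>2\<close> converge to the
  projection onto the eigenspace of its largest eigenvalue.\<close>

lemma spectral_projection:
  assumes H: "H \<in> \<A>" and sa: "star H = H" and nz: "hs M (conv M H H) > 0"
  obtains Q l where "projection Q" "Re (tr M Q) \<ge> 1" "l > 0"
    "conv M (conv M H H) Q = (\<lambda>x y. complex_of_real l * Q x y)"
proof -
  \<comment> \<open>\<open>h n\<close> is the power H^(n+1): without a unit the exponents start at
    one, so multiplying two powers adds an extra 1 to the sum of the indices.\<close>
  define h where "h = rec_nat H (\<lambda>_. conv M H)"
  have h0: "h 0 = H" and hSuc: "h (Suc n) = conv M H (h n)" for n by (simp_all add: h_def)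
  have hA: "h n \<in> \<A>" for n by (induction n) (auto simp: h0 hSuc intro: H algebra_conv)
  note hk = kernel[OF hA] and Hk = kernel[OF H]
  have hh: "conv M (h n) (h m) = h (n + m + 1)" for n m
    by (induction n) (simp_all add: h0 hSuc conv_assoc hk Hk)
  have hstar: "star (h n) = h n" for n
  proof (induction n)
    case (Suc n)
    then show ?case using hh[of n 0] by (simp add: hSuc star_conv sa h0)
  qed (simp add: h0 sa)
  define s where "s n = hs M (h n)" for n
  have tr_h: "tr M (h (2 * n + 1)) = of_real (s n)" for n
    using tr_conv_star[of "h n"] hh[of n n] by (simp add: hstar s_def mult_2)
  \<comment> \<open>The trace of H^(2n+4) is split as H^(n+1) times H^(n+3).\<close>
  have lc: "(s (Suc n))\<^sup>2 \<le> s n * s (Suc (Suc n))" for n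
  proof -
    have "(s (Suc n))\<^sup>2 = (cmod (tr M (conv M (h n) (h (Suc (Suc n))))))\<^sup>2"
      using tr_h[of "Suc n"] by (simp add: hh mult_2)
    then show ?thesis using tr_conv_bound[OF hk hk] by (simp add: s_def)
  qed
  have sm: "s (n + m + 1) \<le> s n * s m" for n m
    using hs_conv[OF hk hk, of n m] by (simp add: hh s_def)
  have s_nonneg: "s n \<ge> 0" for n by (simp add: s_def hs_nonneg)
  have s1: "s 1 > 0" using nz by (simp add: s_def hSuc h0)
  have s0: "s 0 > 0" using sm[of 0 0] s1 s_nonneg[of 0] by (cases "s 0 = 0") auto
  have "s n > 0 \<and> s (Suc n) > 0" for n
  proof (induction n)
    case (Suc n)
    then have "0 < s n * s (Suc (Suc n))" using lc[of n] by (smt (verit) zero_less_power)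
    then show ?case using Suc by (simp add: zero_less_mult_iff)
  qed (use s0 s1 in auto)
  then have pos: "s n > 0" for n by blast
  obtain l b where l: "l > 0" and b: "b \<ge> 1" and dec: "decseq (\<lambda>n. s n / l ^ Suc n)"
    and lim: "(\<lambda>n. s n / l ^ Suc n) \<longlonglongrightarrow> b"
    using log_convex_submultiplicative_limit[OF pos lc sm] .
  define B where "B n = s n / l ^ Suc n" for n
  have B_lim: "B \<longlonglongrightarrow> b" and B_dec: "decseq B" using lim dec unfolding B_def by auto
  have B_nonneg: "B n \<ge> 0" for n unfolding B_def using s_nonneg l by simp
  \<comment> \<open>This is the (n+1)-st power of H^2 / l. With even powers of H, both signs of an
    eigenvalue of modulus sqrt l are scaled to 1.\<close>
  define q where "q n = (\<lambda>x y. complex_of_real (1 / l ^ Suc n) * h (2 * n + 1) x y)" for n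
  have qA: "q n \<in> \<A>" for n unfolding q_def by (intro algebra_scale hA)
  note qk = kernel[OF qA]
  have q_star: "star (q n) = q n" for n
    using hstar[of "2 * n + 1"] by (auto simp: q_def star_def fun_eq_iff)
  have q_conv: "conv M (q n) (q m) = q (n + m + 1)" for n m
    unfolding q_def conv_scale_left conv_scale_right hh
    using l by (auto simp: fun_eq_iff power_add algebra_simps)
  have tr_q: "tr M (q n) = of_real (B n)" for n
    unfolding q_def B_def tr_scale tr_h by simp
  have hs_q: "hs M (q n) = B (2 * n + 1)" for n
    using tr_conv_star[of "q n"] tr_q[of "2 * n + 1"] by (simp add: q_star q_conv mult_2 del: of_real_divide)
  have hs_qq: "hs M (\<lambda>x y. q n x y - q m x y) = B (2 * n + 1) + B (2 * m + 1) - 2 * B (n + m + 1)" for n m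
    using hs_diff[OF qk qk, of n m] tr_q[of "n + m + 1"] by (simp add: hs_q q_star q_conv)
  \<comment> \<open>One iteration, written with one factor H on each side. In this form
    \<open>q (Suc n)\<close> is a sandwich, and Hilbert-Schmidt control of \<open>q n\<close>
    becomes uniform control one step later.\<close>
  have HqH: "conv M H (conv M (q n) H) = (\<lambda>x y. of_real l * q (Suc n) x y)" for n
  proof -
    have "conv M H (conv M (q n) H) = (\<lambda>x y. complex_of_real (1 / l ^ Suc n) * h (2 * Suc n + 1) x y)"
      using hh[of "2 * n + 1" 0] hh[of 0 "2 * n + 2"]
      unfolding q_def conv_scale_left conv_scale_right by (simp add: h0)
    then show ?thesis using l by (auto simp: q_def fun_eq_iff)
  qed
  obtain C where C: "C \<ge> 0" "\<And>x y. cmod (H x y) \<le> C" using kernel_bound[OF Hk] by metis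
  define c where "c = C * C / l"
  have c0: "c \<ge> 0" using C l by (simp add: c_def)
  have unif: "cmod (q (Suc n) x y - q (Suc m) x y) \<le> c * sqrt (hs M (\<lambda>x y. q n x y - q m x y))" for n m x y
  proof -
    have "conv M H (conv M (\<lambda>x y. q n x y - q m x y) H) x y = of_real l * (q (Suc n) x y - q (Suc m) x y)"
      using HqH[of n] HqH[of m]
      by (simp add: conv_diff_left conv_diff_right qk Hk kernel_conv right_diff_distrib)
    then have "l * cmod (q (Suc n) x y - q (Suc m) x y) \<le> C * C * sqrt (hs M (\<lambda>x y. q n x y - q m x y))"
      using sandwich_bound[OF Hk kernel_diff[OF qk qk] Hk C C, of n m x y] l by (simp add: norm_mult)
    then show ?thesis using l by (simp add: c_def field_simps)
  qed
  have bounded: "cmod (q (Suc n) x y) \<le> c * sqrt (B 0)" for n x y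
  proof -
    have "l * cmod (q (Suc n) x y) = cmod (conv M H (conv M (q n) H) x y)"
      using l by (simp add: HqH norm_mult)
    also have "\<dots> \<le> C * C * sqrt (hs M (q n))" by (rule sandwich_bound[OF Hk qk Hk C C])
    also have "\<dots> \<le> C * C * sqrt (B 0)"
      using C(1) decseqD[OF B_dec, of 0 "2 * n + 1"] by (intro mult_left_mono) (auto simp: hs_q)
    finally show ?thesis using l by (simp add: c_def field_simps)
  qed
  have "uniformly_Cauchy_on UNIV (\<lambda>n. case_prod (q (Suc n)))"
  proof (rule uniformly_Cauchy_onI)
    fix e :: real assume e: "e > 0"
    \<comment> \<open>Chosen so that sqrt d = e / (c + 1). The four deviations from b in
      \<open>hs_qq\<close>, one of the three values being counted twice, then cost d/4 each.\<close>
    define d where "d = (e / (c + 1))\<^sup>2"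
    have d: "d > 0" using e c0 by (simp add: d_def)
    obtain N where N: "\<And>n. n \<ge> N \<Longrightarrow> \<bar>B n - b\<bar> < d / 4"
      using LIMSEQ_D[OF B_lim, of "d / 4"] d by auto
    show "\<exists>N. \<forall>w\<in>UNIV. \<forall>m\<ge>N. \<forall>n\<ge>N. dist (case_prod (q (Suc m)) w) (case_prod (q (Suc n)) w) < e"
    proof (intro exI ballI allI impI)
      fix w :: "'a \<times> 'a" and m n assume "m \<ge> N" "n \<ge> N"
      obtain x y where w: "w = (x, y)" by (cases w)
      have "hs M (\<lambda>x y. q m x y - q n x y) < d"
        using N[of "2 * m + 1"] N[of "2 * n + 1"] N[of "m + n + 1"] \<open>m \<ge> N\<close> \<open>n \<ge> N\<close>
        unfolding hs_qq by linarith
      then have "sqrt (hs M (\<lambda>x y. q m x y - q n x y)) < e / (c + 1)"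
        using e c0 by (intro real_less_lsqrt) (auto simp: d_def)
      then have "c * sqrt (hs M (\<lambda>x y. q m x y - q n x y)) \<le> c * (e / (c + 1))"
        using c0 by (intro mult_left_mono) auto
      also have "\<dots> < e" using e c0 by (simp add: field_simps)
      finally show "dist (case_prod (q (Suc m)) w) (case_prod (q (Suc n)) w) < e"
        using unif[of m x y n] by (simp add: w dist_norm)
    qed
  qed
  then obtain Q' where "uniform_limit UNIV (\<lambda>n. case_prod (q (Suc n))) Q' sequentially"
    unfolding uniformly_convergent_eq_Cauchy[symmetric] uniformly_convergent_on_def by blast
  then obtain Q where Q: "uniform_limit UNIV (\<lambda>n. case_prod (q (Suc n))) (case_prod Q) sequentially"
    using case_prod_curry by metis
  have QA: "Q \<in> \<A>" by (rule algebra_limit[OF _ Q]) (rule qA)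
  note Qk = kernel[OF QA]
  have ptw: "(\<lambda>n. q (Suc n) x y) \<longlonglongrightarrow> Q x y" for x y
    using tendsto_uniform_limitI[OF Q, of "(x, y)"] by simp
  have "star Q = Q"
  proof (intro ext)
    fix x y
    have "(\<lambda>n. star (q (Suc n)) x y) \<longlonglongrightarrow> star Q x y"
      unfolding star_def by (intro tendsto_cnj ptw)
    then show "star Q x y = Q x y" unfolding q_star using LIMSEQ_unique[OF _ ptw] by blast
  qed
  moreover have "conv M Q Q = Q"
  proof (intro ext)
    fix x y
    have "(\<lambda>n. conv M (q (Suc n)) (q (Suc n)) x y) \<longlonglongrightarrow> conv M Q Q x y"
      by (rule conv_tendsto[OF qk qk _ bounded bounded ptw ptw Qk Qk]) (simp add: c0 B_nonneg)
    then have 1: "(\<lambda>n. q (2 * n + 3) x y) \<longlonglongrightarrow> conv M Q Q x y"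
      unfolding q_conv by (simp add: mult_2 numeral_3_eq_3)
    \<comment> \<open>The square of \<open>q (Suc n)\<close> is \<open>q (2 * n + 3)\<close>, which
      is term 2n + 2 of the shifted sequence converging to Q.\<close>
    have "strict_mono (\<lambda>n::nat. 2 * n + 2)" by (simp add: strict_mono_def)
    from LIMSEQ_subseq_LIMSEQ[OF ptw[of x y] this]
    have "(\<lambda>n. q (2 * n + 3) x y) \<longlonglongrightarrow> Q x y" by (simp add: o_def numeral_3_eq_3)
    with 1 show "conv M Q Q x y = Q x y" by (rule LIMSEQ_unique)
  qed
  moreover have "tr M Q = of_real b"
  proof (rule LIMSEQ_unique)
    show "(\<lambda>n. tr M (q (Suc n))) \<longlonglongrightarrow> tr M Q" by (rule tr_tendsto[OF qk bounded ptw Qk])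
    show "(\<lambda>n. tr M (q (Suc n))) \<longlonglongrightarrow> of_real b"
      unfolding tr_q using LIMSEQ_Suc[OF B_lim] by (rule tendsto_of_real)
  qed
  moreover have "conv M (conv M H H) Q = (\<lambda>x y. of_real l * Q x y)"
  proof (intro ext)
    fix x y
    have HHk: "conv M H H \<in> kernels M" by (intro kernel_conv Hk)
    obtain D where D: "D \<ge> 0" "\<And>x y. cmod (conv M H H x y) \<le> D" using kernel_bound[OF HHk] by metis
    have "conv M (conv M H H) (q n) = (\<lambda>x y. of_real l * q (Suc n) x y)" for n
      using hh[of 1 "2 * n + 1"] l unfolding q_def conv_scale_right by (auto simp: h0 hSuc fun_eq_iff)
    moreover have "(\<lambda>n. conv M (conv M H H) (q (Suc n)) x y) \<longlonglongrightarrow> conv M (conv M H H) Q x y"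
      by (rule conv_tendsto[OF HHk qk D bounded tendsto_const ptw HHk Qk])
    ultimately have 1: "(\<lambda>n. of_real l * q (Suc (Suc n)) x y) \<longlonglongrightarrow> conv M (conv M H H) Q x y" by simp
    have "(\<lambda>n. of_real l * q (Suc (Suc n)) x y) \<longlonglongrightarrow> of_real l * Q x y"
      by (intro tendsto_mult tendsto_const LIMSEQ_Suc[OF ptw])
    with 1 show "conv M (conv M H H) Q x y = of_real l * Q x y" by (rule LIMSEQ_unique)
  qed
  ultimately show thesis using that[of Q l] QA b l by (simp add: projection_def)
qed

lemma projection_hs: "projection Q \<Longrightarrow> hs M Q = Re (tr M Q)"
  using tr_conv_star[of Q] by (simp add: projection_def)

definition minimal_projection :: "('a \<Rightarrow> 'a \<Rightarrow> complex) \<Rightarrow> bool" where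
  "minimal_projection E \<longleftrightarrow> projection E \<and> hs M E > 0 \<and>
     (\<forall>Q. projection Q \<longrightarrow> hs M Q > 0 \<longrightarrow> conv M E Q = Q \<longrightarrow> Q = E)"

text \<open>If Q lies under E, then E - Q is a projection and \<open>hs\<close> is additive along
  the splitting. A nonzero Q takes away at least 1, so a nonzero remainder would have a smaller
  integer part than E. Minimising the integer part, a natural number, therefore leaves no proper
  subprojection.\<close>

lemma minimal_projection_exists:
  assumes "H \<in> \<A>" "star H = H" "hs M (conv M H H) > 0"
  obtains E where "minimal_projection E"
proof -
  define P where "P Q \<longleftrightarrow> projection Q \<and> hs M Q > 0" for Q
  obtain Q0 where "P Q0"
    using spectral_projection[OF assms] projection_hs unfolding P_def by (metis less_le_trans zero_less_one)
  define E where "E = arg_min (\<lambda>Q. nat \<lfloor>hs M Q\<rfloor>) P"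
  have E: "P E" and E_min: "\<And>Q. P Q \<Longrightarrow> nat \<lfloor>hs M E\<rfloor> \<le> nat \<lfloor>hs M Q\<rfloor>"
    using arg_min_nat_lemma[where P=P and k=Q0 and m= "\<lambda>Q. nat \<lfloor>hs M Q\<rfloor>"] \<open>P Q0\<close> unfolding E_def by auto
  have Ep: "E \<in> \<A>" "star E = E" "conv M E E = E" using E by (auto simp: P_def projection_def)
  have "Q = E" if Q: "projection Q" "hs M Q > 0" "conv M E Q = Q" for Q
  proof -
    have Qp: "Q \<in> \<A>" "star Q = Q" "conv M Q Q = Q" using Q by (auto simp: projection_def)
    note Qk = kernel[OF Qp(1)] and Ek = kernel[OF Ep(1)]
    have QE: "conv M Q E = Q" using star_conv[of E Q] Q(3) Qp Ep by simp
    define D where "D = (\<lambda>x y. E x y - Q x y)"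
    have DA: "D \<in> \<A>" unfolding D_def by (intro algebra_diff Ep Qp)
    note Dk = kernel[OF DA]
    have "star D = D" using Ep(2) Qp(2) by (auto simp: D_def star_def fun_eq_iff)
    moreover have DD: "conv M D D = D"
      unfolding D_def by (simp add: conv_diff_left conv_diff_right Ek Qk kernel_diff Ep Qp QE Q(3))
    ultimately have pD: "projection D" using DA by (simp add: projection_def)
    have "hs M D = hs M E - hs M Q"
      using projection_hs[OF pD] projection_hs[OF Q(1)] projection_hs E Ek Qk
      by (simp add: D_def tr_diff P_def)
    \<comment> \<open>From Q = Q Q one gets \<open>hs M Q\<close> at most its own square, and it is
      positive.\<close>
    moreover have "hs M Q \<ge> 1"
      using hs_conv[OF Qk Qk] Q(2) Qp(3) by simp
    moreover have "nat \<lfloor>hs M E\<rfloor> \<le> nat \<lfloor>hs M D\<rfloor>" if "hs M D > 0"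
      using E_min pD that by (simp add: P_def)
    ultimately have "hs M D = 0" using hs_nonneg[of D] by linarith
    \<comment> \<open>D equals D D D, so vanishing almost everywhere means vanishing
      everywhere.\<close>
    then have "D = (\<lambda>x y. 0)"
      using sandwich_null[OF Dk Dk Dk] DD by simp
    then show ?thesis by (auto simp: D_def fun_eq_iff)
  qed
  then show thesis using that[of E] E by (simp add: minimal_projection_def P_def)
qed

section \<open>The corner of a minimal projection consists of scalars\<close>

context
  fixes E assumes E: "minimal_projection E"
begin

lemma minimal_props: "E \<in> \<A>" "star E = E" "conv M E E = E"
  using E by (auto simp: minimal_projection_def projection_def)

text \<open>The spectral projection Q of H^2 satisfies l Q = H^2 Q, and E fixes H from the left, so
  Q lies under E and minimality gives Q = E. Then H^2 = H^2 E = l E. If H^2 is null, sandwiching it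
  between two copies of E shows that it is zero.\<close>

lemma minimal_corner_square:
  assumes H: "H \<in> \<A>" "star H = H" "conv M E H = H"
  obtains l where "conv M H H = (\<lambda>x y. complex_of_real l * E x y)"
proof -
  note Hk = kernel[OF H(1)] and Ek = kernel[OF minimal_props(1)]
  have HHk: "conv M H H \<in> kernels M" by (intro kernel_conv Hk)
  have HE: "conv M H E = H" using star_conv[of E H] H minimal_props by simp
  show thesis
  proof (cases "hs M (conv M H H) = 0")
    case True
    have "conv M E (conv M (conv M H H) E) = conv M H H"
      using Hk Ek HE H(3) by (simp add: conv_assoc kernel_conv flip: conv_assoc[of E H H])
    then show thesis using that[of 0] sandwich_null[OF Ek HHk Ek True] by simp
  next
    case False
    then have "hs M (conv M H H) > 0" using hs_nonneg[of "conv M H H"] by simp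
    then obtain Q l where Q: "projection Q" "Re (tr M Q) \<ge> 1" "l > 0"
      "conv M (conv M H H) Q = (\<lambda>x y. complex_of_real l * Q x y)"
      using spectral_projection[OF H(1,2)] by metis
    have Qk: "Q \<in> kernels M" using Q(1) kernel by (simp add: projection_def)
    have "conv M E (conv M (conv M H H) Q) = conv M (conv M H H) Q"
      using Hk Ek Qk H(3) by (simp add: kernel_conv flip: conv_assoc)
    then have "(\<lambda>x y. complex_of_real l * conv M E Q x y) = (\<lambda>x y. complex_of_real l * Q x y)"
      unfolding Q(4) conv_scale_right .
    then have "conv M E Q = Q" using Q(3) by (auto simp: fun_eq_iff)
    then have "Q = E" using E Q(1,2) projection_hs[OF Q(1)] by (simp add: minimal_projection_def)
    then have "conv M H H = (\<lambda>x y. complex_of_real l * E x y)"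
      using Q(4) HE Hk Ek by (simp add: conv_assoc)
    then show thesis by (rule that)
  qed
qed

text \<open>Polarisation: the squares of \<open>H\<close> and of \<open>H + E\<close> are both multiples of \<open>E\<close>.\<close>

lemma minimal_corner_self_adjoint:
  assumes H: "H \<in> \<A>" "star H = H" "conv M E H = H"
  obtains c where "H = (\<lambda>x y. c * E x y)"
proof -
  note Hk = kernel[OF H(1)] and Ek = kernel[OF minimal_props(1)]
  have HE: "conv M H E = H" using star_conv[of E H] H minimal_props by simp
  obtain l where l: "conv M H H = (\<lambda>x y. complex_of_real l * E x y)" by (rule minimal_corner_square[OF H])
  let ?G = "\<lambda>x y. H x y + E x y"
  have "star ?G = ?G" using H(2) minimal_props(2) by (auto simp: star_def fun_eq_iff)
  moreover have "conv M E ?G = ?G" using H(3) minimal_props(3) Hk Ek by (simp add: conv_add_right)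
  ultimately obtain l' where "conv M ?G ?G = (\<lambda>x y. complex_of_real l' * E x y)"
    using minimal_corner_square[of ?G] algebra_add[OF H(1) minimal_props(1)] by metis
  moreover have "conv M ?G ?G = (\<lambda>x y. of_real l * E x y + 2 * H x y + E x y)"
    using l HE H(3) minimal_props(3) Hk Ek by (simp add: conv_add_right conv_add_left kernel_add fun_eq_iff)
  ultimately have "of_real l * E x y + 2 * H x y + E x y = of_real l' * E x y" for x y
    by (metis (mono_tags, lifting))
  then have "H x y = ((of_real l' - of_real l - 1) / 2) * E x y" for x y
    by (simp add: field_simps)
  then show thesis by (intro that ext)
qed

text \<open>Cartesian decomposition: \<open>?H\<close> and \<open>?G\<close> are self-adjoint, E
  fixes both from the left, and X is half of \<open>?H\<close> minus half of i times
  \<open>?G\<close>.\<close>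

lemma minimal_corner:
  assumes X: "X \<in> \<A>" "conv M E X = X" "conv M X E = X"
  obtains c where "X = (\<lambda>x y. c * E x y)"
proof -
  note Xk = kernel[OF X(1)] and Ek = kernel[OF minimal_props(1)]
  have Xs: "star X \<in> \<A>" "conv M E (star X) = star X"
    using algebra_star[OF X(1)] star_conv[of X E] X(3) minimal_props(2) by auto
  note Xsk = kernel[OF Xs(1)]
  let ?H = "\<lambda>x y. X x y + star X x y" and ?G = "\<lambda>x y. \<i> * (X x y - star X x y)"
  have sa: "star ?H = ?H" "star ?G = ?G" by (auto simp: star_def fun_eq_iff algebra_simps)
  have mem: "?H \<in> \<A>" "?G \<in> \<A>" by (intro algebra_add algebra_scale algebra_diff X Xs)+
  have E_left: "conv M E ?H = ?H" "conv M E ?G = ?G"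
    using X Xs Xk Ek Xsk by (simp_all add: conv_add_right conv_diff_right conv_scale_right)
  obtain a where "?H = (\<lambda>x y. a * E x y)"
    by (rule minimal_corner_self_adjoint[OF mem(1) sa(1) E_left(1)])
  moreover obtain b where "?G = (\<lambda>x y. b * E x y)"
    by (rule minimal_corner_self_adjoint[OF mem(2) sa(2) E_left(2)])
  ultimately have "X x y + star X x y = a * E x y" "\<i> * (X x y - star X x y) = b * E x y" for x y
    by (auto simp: fun_eq_iff)
  moreover have "X x y = ((X x y + star X x y) - \<i> * (\<i> * (X x y - star X x y))) / 2" for x y
    by (simp add: algebra_simps)
  ultimately have "X x y = (a - \<i> * b) / 2 * E x y" for x y
    by (simp add: algebra_simps)
  then show thesis by (intro that ext)
qed

end

end

subsection \<open>Ergodicity of the square of a commuting family\<close>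

definition mp_map :: "'a measure \<Rightarrow> ('a \<Rightarrow> 'a) \<Rightarrow> bool" where
  "mp_map M T \<longleftrightarrow> T \<in> M \<rightarrow>\<^sub>M M \<and> distr M M T = M"

text \<open>The orthogonal projection onto the constants, cut off at the carrier so that it belongs
  to \<open>kernels\<close>.\<close>

definition one_kernel :: "'a measure \<Rightarrow> 'a \<Rightarrow> 'a \<Rightarrow> complex" where
  "one_kernel M x y = (if x \<in> space M \<and> y \<in> space M then 1 else 0)"

text \<open>For a measure-preserving T this makes the integral operator of K commute with
  composition by T, as the substitution of T y for y shows.\<close>

definition invariant_kernel :: "'a measure \<Rightarrow> ('a \<Rightarrow> 'a) \<Rightarrow> ('a \<Rightarrow> 'a \<Rightarrow> complex) \<Rightarrow> bool" where
  "invariant_kernel M T K \<longleftrightarrow>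
     (AE w in M \<Otimes>\<^sub>M M. K (T (fst w)) (T (snd w)) = K (fst w) (snd w))"

lemma mp_map_measurable: "mp_map M T \<Longrightarrow> T \<in> M \<rightarrow>\<^sub>M M"
  by (simp add: mp_map_def)

lemma mp_map_space: "mp_map M T \<Longrightarrow> x \<in> space M \<Longrightarrow> T x \<in> space M"
  by (meson mp_map_measurable measurable_space)

lemma mp_map_AE: "mp_map M T \<Longrightarrow> AE x in M. P x \<Longrightarrow> AE x in M. P (T x)"
  using AE_distrD[of T M M P] unfolding mp_map_def by metis

lemma mp_map_integral:
  fixes f :: "'a \<Rightarrow> 'b::{banach, second_countable_topology}"
  assumes "mp_map M T" "f \<in> borel_measurable M"
  shows "(LINT x|M. f (T x)) = (LINT x|M. f x)"
  using integral_distr[of T M M f] assms by (simp add: mp_map_def)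

context prob_space
begin

lemma mp_map_id: "mp_map M (\<lambda>x. x)"
  by (simp add: mp_map_def distr_id)

lemma mp_map_pair:
  assumes T: "mp_map M T" and U: "mp_map M U"
  shows "mp_map (M \<Otimes>\<^sub>M M) (map_prod T U)"
proof -
  have TU: "distr M M T = M" "distr M M U = M" using T U by (simp_all add: mp_map_def)
  have "map_prod T U \<in> M \<Otimes>\<^sub>M M \<rightarrow>\<^sub>M M \<Otimes>\<^sub>M M"
    unfolding map_prod_def split_beta'
    by (intro measurable_Pair measurable_compose[OF measurable_fst mp_map_measurable[OF T]]
        measurable_compose[OF measurable_snd mp_map_measurable[OF U]])
  moreover have "distr M M T \<Otimes>\<^sub>M distr M M U = distr (M \<Otimes>\<^sub>M M) (M \<Otimes>\<^sub>M M) (\<lambda>(x, y). (T x, U y))"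
    by (rule pair_measure_distr[OF mp_map_measurable[OF T] mp_map_measurable[OF U]])
      (simp only: TU sigma_finite_measure_axioms)
  ultimately show ?thesis unfolding TU by (simp add: mp_map_def map_prod_def)
qed

lemma mp_map_swap: "mp_map (M \<Otimes>\<^sub>M M) (\<lambda>(x, y). (y, x))"
proof -
  interpret P: pair_prob_space M M ..
  show ?thesis unfolding mp_map_def using measurable_pair_swap' P.distr_pair_swap[symmetric] by blast
qed

lemma AE_pair_nested:
  assumes "AE w in M \<Otimes>\<^sub>M M. P (fst w) (snd w)"
  shows "AE x in M. AE y in M. P x y" and "AE y in M. AE x in M. P x y"
proof -
  interpret P: pair_prob_space M M ..
  show "AE x in M. AE y in M. P x y" using P.AE_pair[OF assms] by simp
  have "AE w in M \<Otimes>\<^sub>M M. P (snd w) (fst w)"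
    using mp_map_AE[OF mp_map_swap assms] by (simp add: split_beta')
  from P.AE_pair[OF this] show "AE y in M. AE x in M. P x y" by simp
qed

lemma AE_pair_eqI:
  fixes f g :: "'a \<Rightarrow> 'a \<Rightarrow> complex"
  assumes f: "(\<lambda>w. f (fst w) (snd w)) \<in> borel_measurable (M \<Otimes>\<^sub>M M)" 
    and g: "(\<lambda>w. g (fst w) (snd w)) \<in> borel_measurable (M \<Otimes>\<^sub>M M)"
    and AE: "AE x in M. AE y in M. f x y = g x y"
  shows "AE w in M \<Otimes>\<^sub>M M. f (fst w) (snd w) = g (fst w) (snd w)"
proof -
  interpret P: pair_prob_space M M ..
  show ?thesis using f g AE by (intro P.AE_pair_measure) auto
qed

lemma one_kernel_kernel: "one_kernel M \<in> kernels M"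
proof -
  have "case_prod (one_kernel M) = indicator (space (M \<Otimes>\<^sub>M M))"
    by (auto simp: one_kernel_def space_pair_measure indicator_def fun_eq_iff)
  then show ?thesis by (intro kernelsI[where C=1]) (auto simp: one_kernel_def)
qed

lemma star_one_kernel: "star (one_kernel M) = one_kernel M"
  by (simp add: star_def one_kernel_def fun_eq_iff)

lemma conv_one_kernel_right: "y \<in> space M \<Longrightarrow> conv M K (one_kernel M) x y = (LINT z|M. K x z)"
  unfolding conv_def one_kernel_def by (intro Bochner_Integration.integral_cong) auto

lemma conv_one_kernel_left: "x \<in> space M \<Longrightarrow> conv M (one_kernel M) K x y = (LINT z|M. K z y)"
  unfolding conv_def one_kernel_def by (intro Bochner_Integration.integral_cong) auto

lemma conv_mp_map:
  assumes K: "K \<in> kernels M" and L: "L \<in> kernels M" and T: "mp_map M T"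
  shows "conv M K L x y = (LINT z|M. K x (T z) * L (T z) y)"
  unfolding conv_def
  by (rule mp_map_integral[OF T, symmetric], rule borel_measurable_integrable, rule kernel_mult_integrable[OF K L])

lemma kernel_map_measurable:
  assumes K: "K \<in> kernels M" and T: "mp_map M T" and U: "mp_map M U"
  shows "(\<lambda>w. K (T (fst w)) (U (snd w))) \<in> borel_measurable (M \<Otimes>\<^sub>M M)"
  by (intro kernel_measurable_comp[OF K] measurable_compose[OF measurable_fst mp_map_measurable[OF T]]
      measurable_compose[OF measurable_snd mp_map_measurable[OF U]])

text \<open>Substituting T z for the integration variable puts T into both factors at once.
  Invariance holds almost everywhere on the product, so it is applied on almost every row of K and
  almost every column of L.\<close>

lemma invariant_conv:
  assumes K: "K \<in> kernels M" and L: "L \<in> kernels M" and T: "mp_map M T"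
    and invK: "invariant_kernel M T K" and invL: "invariant_kernel M T L"
  shows "invariant_kernel M T (conv M K L)"
  unfolding invariant_kernel_def
proof (rule AE_pair_eqI)
  have KL: "conv M K L \<in> kernels M" by (intro kernel_conv K L)
  show "(\<lambda>w. conv M K L (T (fst w)) (T (snd w))) \<in> borel_measurable (M \<Otimes>\<^sub>M M)"
    by (rule kernel_map_measurable[OF KL T T])
  show "(\<lambda>w. conv M K L (fst w) (snd w)) \<in> borel_measurable (M \<Otimes>\<^sub>M M)"
    by (rule kernel_map_measurable[OF KL mp_map_id mp_map_id])
  have 1: "AE x in M. AE z in M. K (T x) (T z) = K x z"
    using invK unfolding invariant_kernel_def by (rule AE_pair_nested(1))
  have 2: "AE y in M. AE z in M. L (T z) (T y) = L z y"
    using invL unfolding invariant_kernel_def by (rule AE_pair_nested(2))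
  have 3: "conv M K L (T x) (T y) = conv M K L x y"
    if "AE z in M. K (T x) (T z) = K x z" "AE z in M. L (T z) (T y) = L z y" for x y
  proof -
    have [measurable]: "(\<lambda>z. K (T x) (T z) * L (T z) (T y)) \<in> borel_measurable M"
      by (intro borel_measurable_times kernel_measurable_row[OF K] kernel_measurable_col[OF L] mp_map_measurable[OF T])
    have [measurable]: "(\<lambda>z. K x z * L z y) \<in> borel_measurable M"
      by (intro borel_measurable_times kernel_measurable_row[OF K] kernel_measurable_col[OF L]) auto
    have "conv M K L (T x) (T y) = (LINT z|M. K (T x) (T z) * L (T z) (T y))"
      by (rule conv_mp_map[OF K L T])
    also have "\<dots> = (LINT z|M. K x z * L z y)"
    proof (rule integral_cong_AE)
      show "AE z in M. K (T x) (T z) * L (T z) (T y) = K x z * L z y"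
        using that by eventually_elim simp
    qed measurable
    finally show ?thesis by (simp add: conv_def)
  qed
  from 1 show "AE x in M. AE y in M. conv M K L (T x) (T y) = conv M K L x y"
  proof eventually_elim
    case (elim x)
    from 2 show ?case by eventually_elim (rule 3[OF elim])
  qed
qed

lemma invariant_star: 
  assumes "invariant_kernel M T K"
  shows "invariant_kernel M T (star K)"
  using mp_map_AE[OF mp_map_swap assms[unfolded invariant_kernel_def]]
  by (simp add: invariant_kernel_def star_def split_beta')

text \<open>A kernel \<open>K\<close> with \<open>K\<^sup>* K = 0\<close> satisfies \<open>K V = 0\<close> for every kernel \<open>V\<close>; taking for \<open>V\<close>
  indicators of sets, the integral of \<open>K\<close> over every measurable rectangle vanishes.\<close>

lemma hs_eq_0_if_star_conv:
  assumes K: "K \<in> kernels M" and z: "hs M (conv M (star K) K) = 0"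
  shows "hs M K = 0"
proof -
  interpret P: pair_prob_space M M ..
  let ?N = "M \<Otimes>\<^sub>M M"
  note Ks = kernel_star[OF K]
  obtain D where D: "D \<ge> 0" "\<And>x y. cmod (K x y) \<le> D" using kernel_bound[OF K] by metis
  have K_int: "integrable ?N (case_prod K)"
    using D by (intro P.integrable_bounded[where C=D] kernel_measurable[OF K]) auto
  have set_int: "set_integrable ?N S (case_prod K)" if "S \<in> sets ?N" for S
    unfolding set_integrable_def using K_int that by (intro integrable_mult_indicator)
  have rect: "(LINT w:B \<times> C|?N. case_prod K w) = 0" if B: "B \<in> sets M" and C: "C \<in> sets M" for B C
  proof -
    \<comment> \<open>On the carrier V does not depend on y, so K V at x is the integral of row x of
      K over C.\<close>
    define V :: "'a \<Rightarrow> 'a \<Rightarrow> complex" where "V x y = indicator C x * indicator (space M) y" for x y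
    have V: "V \<in> kernels M"
    proof (rule kernelsI[where C=1])
      show "case_prod V \<in> borel_measurable ?N"
        unfolding V_def split_beta' using C by measurable
      show "V x y = 0" if "x \<notin> space M \<or> y \<notin> space M" for x y
        using that sets.sets_into_space[OF C] by (auto simp: V_def indicator_def)
    qed (auto simp: V_def indicator_def)
    note KV = kernel_conv[OF K V] and Vs = kernel_star[OF V]
    have "conv M (star (conv M K V)) (conv M K V) = conv M (star V) (conv M (conv M (star K) K) V)"
      by (simp add: star_conv conv_assoc K Ks V Vs kernel_conv)
    also have "\<dots> = (\<lambda>x y. 0)" by (intro sandwich_null Vs V kernel_conv K Ks z)
    finally have "tr M (conv M (conv M K V) (star (conv M K V))) = 0"
      by (subst tr_commute[OF KV kernel_star[OF KV]]) (simp add: tr_def)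
    then have "hs M (conv M K V) = 0" by (simp add: tr_conv_star)
    then have "AE w in ?N. conv M K V (fst w) (snd w) = 0"
      using hs_eq_0_iff[OF KV] by (simp add: split_beta')
    from AE_pair_nested(1)[OF this] have row0: "AE x in M. (LINT z|M. indicator C z * K x z) = 0"
    proof (eventually_elim)
      case (elim x)
      \<comment> \<open>Since the value is the same for all y in the carrier, one good point
        suffices, and a set of full measure contains one.\<close>
      have "\<exists>y\<in>space M. conv M K V x y = 0"
      proof (rule ccontr)
        assume "\<not> ?thesis"
        then have "AE y in M. False" using elim by (auto elim: AE_mp)
        then show False by simp
      qed
      then obtain y where "y \<in> space M" "conv M K V x y = 0" by blast
      then show ?case by (simp add: conv_def V_def mult.commute)
    qed
    have "(LINT x|M. indicator B x * (LINT z|M. indicator C z * K x z)) = 0"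
      by (rule integral_eq_zero_AE) (use row0 in \<open>eventually_elim, simp\<close>)
    moreover have m: "(\<lambda>(x, y). indicator B x * (indicator C y * K x y)) \<in> borel_measurable ?N"
      using B C kernel_measurable[OF K] unfolding split_beta' by measurable
    have "(LINT x|M. LINT z|M. indicator B x * (indicator C z * K x z)) = (LINT w|?N. (\<lambda>(x, y). indicator B x * (indicator C y * K x y)) w)"
      by (rule fubini_bounded(2)[OF m, where C=D]) (use D in \<open>auto simp: norm_mult indicator_def\<close>)
    moreover have "(LINT w|?N. (\<lambda>(x, y). indicator B x * (indicator C y * K x y)) w) = (LINT w:B \<times> C|?N. case_prod K w)"
      unfolding set_lebesgue_integral_def by (intro Bochner_Integration.integral_cong) (auto simp: indicator_def)
    ultimately show ?thesis by simp
  qed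
  \<comment> \<open>Rectangles are an intersection-stable generator, and the sets over which K
    integrates to zero are closed under complements and countable disjoint unions.\<close>
  have all: "(LINT w:S|?N. case_prod K w) = 0" if "S \<in> sets ?N" for S
  proof -
    have "S \<in> sigma_sets (space M \<times> space M) {a \<times> b | a b. a \<in> sets M \<and> b \<in> sets M}"
      using that by (simp add: sets_pair_measure)
    with Int_stable_pair_measure_generator pair_measure_closed show ?thesis
    proof (induction S rule: sigma_sets_induct_disjoint)
      case (basic S)
      then show ?case using rect by auto
    next
      case empty
      then show ?case by (simp add: set_lebesgue_integral_def)
    next
      case (compl S)
      have S: "S \<in> sets ?N" using compl(1) by (simp add: sets_pair_measure)
      have "(LINT w:(space M \<times> space M)|?N. case_prod K w) = (LINT w:S|?N. case_prod K w) + (LINT w:(space M \<times> space M - S)|?N. case_prod K w)"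
      proof (subst set_integral_Un[symmetric])
        have "S \<subseteq> space M \<times> space M" using sets.sets_into_space[OF S] by (simp add: space_pair_measure)
        then show "(LINT w:(space M \<times> space M)|?N. case_prod K w) = (LINT w:S \<union> (space M \<times> space M - S)|?N. case_prod K w)"
          by (simp add: Un_absorb1)
      qed (use S in \<open>auto intro!: set_int simp flip: space_pair_measure\<close>)
      then show ?case using compl(2) rect[of "space M" "space M"] by simp
    next
      case (union S)
      have S: "S i \<in> sets ?N" for i using union(2) by (auto simp: sets_pair_measure)
      have "(LINT w:(\<Union>i. S i)|?N. case_prod K w) = (\<Sum>i. LINT w:S i|?N. case_prod K w)"
        using S union(1) by (intro lebesgue_integral_countable_add set_int) (auto simp: disjoint_family_on_def)
      then show ?case using union(3) by simp
    qed
  qed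
  have "AE w in ?N. Re (case_prod K w) = 0"
  proof (rule density_unique_real)
    show "integrable ?N (\<lambda>w. Re (case_prod K w))" using K_int by simp
    fix S assume S: "S \<in> sets ?N"
    have "(LINT w:S|?N. Re (case_prod K w)) = Re (LINT w:S|?N. case_prod K w)"
      using set_int[OF S] unfolding set_lebesgue_integral_def set_integrable_def by (simp flip: integral_Re)
    then show "(LINT w:S|?N. Re (case_prod K w)) = (LINT w:S|?N. 0)" using all[OF S] by (simp add: set_lebesgue_integral_def)
  qed simp
  moreover have "AE w in ?N. Im (case_prod K w) = 0"
  proof (rule density_unique_real)
    show "integrable ?N (\<lambda>w. Im (case_prod K w))" using K_int by simp
    fix S assume S: "S \<in> sets ?N"
    have "(LINT w:S|?N. Im (case_prod K w)) = Im (LINT w:S|?N. case_prod K w)"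
      using set_int[OF S] unfolding set_lebesgue_integral_def set_integrable_def by (simp flip: integral_Im)
    then show "(LINT w:S|?N. Im (case_prod K w)) = (LINT w:S|?N. 0)" using all[OF S] by (simp add: set_lebesgue_integral_def)
  qed simp
  ultimately have "AE w in ?N. case_prod K w = 0" by eventually_elim (simp add: complex_eq_iff)
  then show ?thesis using hs_eq_0_iff[OF K] by simp
qed

end

section \<open>Invariant kernels of a countable commuting family\<close>

locale commuting_maps = prob_space M for M :: "'a measure" +
  fixes \<T> :: "('a \<Rightarrow> 'a) set"
  assumes maps: "T \<in> \<T> \<Longrightarrow> mp_map M T"
    and maps_commute: "\<lbrakk>T \<in> \<T>; U \<in> \<T>; x \<in> space M\<rbrakk> \<Longrightarrow> T (U x) = U (T x)"
    and maps_countable: "countable \<T>"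
begin

text \<open>Composition with \<open>one_kernel\<close> on the left being zero says that all columns
  have mean zero, so a constant column must vanish. The condition on the right makes the set closed
  under \<open>star\<close>.\<close>

definition invariant_kernels :: "('a \<Rightarrow> 'a \<Rightarrow> complex) set" where
  "invariant_kernels = {K \<in> kernels M. (\<forall>T\<in>\<T>. invariant_kernel M T K) \<and>
     conv M K (one_kernel M) = (\<lambda>x y. 0) \<and> conv M (one_kernel M) K = (\<lambda>x y. 0)}"

sublocale kernel_algebra M invariant_kernels
proof
  show "invariant_kernels \<subseteq> kernels M" unfolding invariant_kernels_def by blast
next
  fix K L assume "K \<in> invariant_kernels" "L \<in> invariant_kernels"
  then show "(\<lambda>x y. K x y + L x y) \<in> invariant_kernels"
    unfolding invariant_kernels_def invariant_kernel_def
    by (auto simp: kernel_add conv_add_left conv_add_right one_kernel_kernel elim!: ballE[where x=T for T] AE_mp)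
next
  fix K c assume "K \<in> invariant_kernels"
  then show "(\<lambda>x y. c * K x y) \<in> invariant_kernels"
    unfolding invariant_kernels_def invariant_kernel_def
    by (auto simp: kernel_scale conv_scale_left conv_scale_right)
next
  fix K L assume KL: "K \<in> invariant_kernels" "L \<in> invariant_kernels"
  then have k: "K \<in> kernels M" "L \<in> kernels M" by (auto simp: invariant_kernels_def)
  have "conv M K (\<lambda>x y. 0) = (\<lambda>x y. 0)" "conv M (\<lambda>x y. 0) L = (\<lambda>x y. 0)" by (simp_all add: conv_def)
  then show "conv M K L \<in> invariant_kernels"
    using KL k unfolding invariant_kernels_def
    by (auto simp: kernel_conv conv_assoc one_kernel_kernel maps invariant_conv simp flip: conv_assoc[of "one_kernel M"])
next
  fix K assume K: "K \<in> invariant_kernels"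
  have "star (conv M K (one_kernel M)) = (\<lambda>x y. 0)" "star (conv M (one_kernel M) K) = (\<lambda>x y. 0)"
    using K by (simp_all add: invariant_kernels_def star_def)
  then show "star K \<in> invariant_kernels"
    using K by (auto simp: invariant_kernels_def kernel_star invariant_star star_conv star_one_kernel)
next
  fix k K assume k: "\<And>n. k n \<in> invariant_kernels"
    and lim: "uniform_limit UNIV (\<lambda>n. case_prod (k n)) (case_prod K) sequentially"
  have kk: "k n \<in> kernels M" for n using k by (simp add: invariant_kernels_def)
  have Kk: "K \<in> kernels M" by (rule kernel_uniform_limit[OF kk lim])
  have ptw: "(\<lambda>n. k n x y) \<longlonglongrightarrow> K x y" for x y
    using tendsto_uniform_limitI[OF lim, of "(x, y)"] by simp
  have "invariant_kernel M T K" if "T \<in> \<T>" for T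
  proof -
    have "AE w in M \<Otimes>\<^sub>M M. \<forall>n. k n (T (fst w)) (T (snd w)) = k n (fst w) (snd w)"
      using k that unfolding AE_all_countable by (simp add: invariant_kernels_def invariant_kernel_def)
    then show ?thesis unfolding invariant_kernel_def
    proof eventually_elim
      case (elim w)
      then show ?case
        using ptw[of "T (fst w)" "T (snd w)"] ptw[of "fst w" "snd w"] LIMSEQ_unique by simp
    qed
  qed
  moreover obtain N where N: "\<And>n w. n \<ge> N \<Longrightarrow> dist (case_prod (k n) w) (case_prod K w) < 1"
    using uniform_limitD[OF lim, of 1] unfolding eventually_sequentially by auto
  obtain C where C: "C \<ge> 0" "\<And>x y. cmod (K x y) \<le> C" using kernel_bound[OF Kk] by metis
  \<comment> \<open>Closeness to K holds only from N on, hence the shifted sequence for dominated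
    convergence.\<close>
  have bd: "cmod (k (n + N) x y) \<le> C + 1" for n x y
    using N[of "n + N" "(x, y)"] C(2)[of x y] norm_triangle_ineq2[of "k (n + N) x y" "K x y"]
    by (simp add: dist_norm)
  have one: "cmod (one_kernel M x y) \<le> 1" for x y by (simp add: one_kernel_def)
  have ptw': "(\<lambda>n. k (n + N) x y) \<longlonglongrightarrow> K x y" for x y using ptw by (rule LIMSEQ_ignore_initial_segment)
  have "(\<lambda>n. conv M (k (n + N)) (one_kernel M) x y) \<longlonglongrightarrow> conv M K (one_kernel M) x y" for x y
    by (rule conv_tendsto[OF kk one_kernel_kernel _ bd one ptw' tendsto_const Kk one_kernel_kernel]) (use C in simp)
  then have "conv M K (one_kernel M) = (\<lambda>x y. 0)"
    using k LIMSEQ_unique[OF _ tendsto_const] by (fastforce simp: invariant_kernels_def fun_eq_iff)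
  moreover have "(\<lambda>n. conv M (one_kernel M) (k (n + N)) x y) \<longlonglongrightarrow> conv M (one_kernel M) K x y" for x y
    by (rule conv_tendsto[OF one_kernel_kernel kk _ one bd tendsto_const ptw' one_kernel_kernel Kk]) simp
  then have "conv M (one_kernel M) K = (\<lambda>x y. 0)"
    using k LIMSEQ_unique[OF _ tendsto_const] by (fastforce simp: invariant_kernels_def fun_eq_iff)
  ultimately show "K \<in> invariant_kernels" using Kk by (simp add: invariant_kernels_def)
qed

text \<open>Composition by T applied to E. Here commutativity is used: T (S x) = S (T x) lets the
  invariance of E under S act on the translated kernel. The cut-off is needed because T is arbitrary
  off the carrier.\<close>

lemma translate_kernel:
  assumes E: "E \<in> invariant_kernels" and T: "T \<in> \<T>"
  shows "(\<lambda>x y. if x \<in> space M then E (T x) y else 0) \<in> invariant_kernels" (is "?U \<in> _")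
proof -
  have Ek: "E \<in> kernels M" using E by (simp add: invariant_kernels_def)
  obtain C where C: "C \<ge> 0" "\<And>x y. cmod (E x y) \<le> C" using kernel_bound[OF Ek] by metis
  have m: "case_prod ?U \<in> borel_measurable (M \<Otimes>\<^sub>M M)"
  proof -
    have "case_prod ?U w = E (T (fst w)) (snd w)" if "w \<in> space (M \<Otimes>\<^sub>M M)" for w
      using that by (auto simp: space_pair_measure)
    then show ?thesis
      using kernel_map_measurable[OF Ek maps[OF T] mp_map_id] by (subst measurable_cong) auto
  qed
  have Uk: "?U \<in> kernels M"
    using m by (rule kernelsI[where C=C]) (use C in \<open>auto simp: kernel_outside[OF Ek]\<close>)
  have "invariant_kernel M S ?U" if S: "S \<in> \<T>" for S
  proof -
    \<comment> \<open>Invariance of E under S, pulled back along the measure-preserving map (x, y)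
      to (T x, y).\<close>
    have "AE w in M \<Otimes>\<^sub>M M. E (S (fst (map_prod T (\<lambda>x. x) w))) (S (snd (map_prod T (\<lambda>x. x) w)))
       = E (fst (map_prod T (\<lambda>x. x) w)) (snd (map_prod T (\<lambda>x. x) w))"
      using E S by (intro mp_map_AE[OF mp_map_pair[OF maps[OF T] mp_map_id]])
        (auto simp: invariant_kernels_def invariant_kernel_def)
    then show ?thesis unfolding invariant_kernel_def
      using AE_space
    proof eventually_elim
      case (elim w)
      then have "fst w \<in> space M" by (auto simp: space_pair_measure)
      then show ?case using elim(1) mp_map_space[OF maps[OF S]] maps_commute[OF T S] by simp
    qed
  qed
  moreover have "conv M ?U (one_kernel M) = (\<lambda>x y. 0)"
  proof (intro ext)
    fix x y
    have "conv M ?U (one_kernel M) x y = (if x \<in> space M then conv M E (one_kernel M) (T x) y else 0)"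
      by (simp add: conv_def)
    then show "conv M ?U (one_kernel M) x y = 0" using E by (simp add: invariant_kernels_def)
  qed
  moreover have "conv M (one_kernel M) ?U = (\<lambda>x y. 0)"
  proof (intro ext)
    fix x y
    show "conv M (one_kernel M) ?U x y = 0"
    proof (cases "x \<in> space M")
      case True
      have "conv M (one_kernel M) ?U x y = (LINT z|M. E (T z) y)"
        unfolding conv_one_kernel_left[OF True] by (intro Bochner_Integration.integral_cong) auto
      also have "\<dots> = (LINT z|M. E z y)"
        by (rule mp_map_integral[OF maps[OF T]]) (intro kernel_measurable_col[OF Ek], simp)
      also have "\<dots> = conv M (one_kernel M) E x y" by (simp add: conv_one_kernel_left True)
      finally show ?thesis using E by (simp add: invariant_kernels_def)
    next
      case False
      then show ?thesis by (simp add: conv_def one_kernel_def)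
    qed
  qed
  ultimately show ?thesis using Uk by (simp add: invariant_kernels_def)
qed

text \<open>The compression of composition by T to the range of E lies in the corner, so it is c E.
  Invariance lets E pass through T, which identifies the compression with the translate of E
  itself.\<close>

lemma minimal_projection_translate:
  assumes E: "minimal_projection E" and T: "T \<in> \<T>"
  obtains c where "AE y in M. AE x in M. E (T x) y = c * E x y"
proof -
  let ?U = "\<lambda>x y. if x \<in> space M then E (T x) y else 0"
  note EA = minimal_props[OF E]
  have UA: "?U \<in> invariant_kernels" by (rule translate_kernel[OF EA(1) T])
  note Ek = kernel[OF EA(1)] and Uk = kernel[OF UA]
  let ?X = "conv M E ?U"
  have "conv M ?U E = ?U"
  proof (intro ext)
    fix x y
    have "conv M ?U E x y = (if x \<in> space M then conv M E E (T x) y else 0)" by (simp add: conv_def)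
    then show "conv M ?U E x y = ?U x y" by (simp add: EA)
  qed
  then have "conv M ?X E = ?X" by (simp add: conv_assoc Ek Uk)
  moreover have "conv M E ?X = ?X" using EA(3) by (simp add: Ek Uk flip: conv_assoc)
  moreover have "?X \<in> invariant_kernels" by (intro algebra_conv EA UA)
  ultimately obtain c where c: "?X = (\<lambda>x y. c * E x y)" using minimal_corner[OF E, of ?X] by metis
  have "AE x in M. AE z in M. E (T x) (T z) = E x z"
    using EA(1) T by (intro AE_pair_nested(1)) (auto simp: invariant_kernels_def invariant_kernel_def)
  then have "AE x in M. \<forall>y. E (T x) y = c * E x y"
  proof eventually_elim
    case (elim x)
    show ?case
    proof
      fix y
      have [measurable]: "(\<lambda>z. E x z * ?U z y) \<in> borel_measurable M"
        by (rule borel_measurable_integrable[OF kernel_mult_integrable[OF Ek Uk]])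
      have [measurable]: "(\<lambda>z. E (T x) (T z) * E (T z) y) \<in> borel_measurable M"
        by (intro borel_measurable_times kernel_measurable_row[OF Ek] kernel_measurable_col[OF Ek] mp_map_measurable[OF maps[OF T]])
      \<comment> \<open>Invariance replaces \<open>E x z\<close> by \<open>E (T x) (T z)\<close>;
        substituting back z for T z leaves E E at (T x, y).\<close>
      have "?X x y = (LINT z|M. E (T x) (T z) * E (T z) y)"
        unfolding conv_def using elim by (intro integral_cong_AE) (auto elim: AE_mp)
      also have "\<dots> = E (T x) y"
        by (simp add: EA(3) flip: conv_mp_map[OF Ek Ek maps[OF T]])
      finally show "E (T x) y = c * E x y" by (simp add: c)
    qed
  qed
  then have "AE w in M \<Otimes>\<^sub>M M. E (T (fst w)) (snd w) = c * E (fst w) (snd w)"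
    using kernel_map_measurable[OF Ek maps[OF T] mp_map_id] kernel_map_measurable[OF kernel_scale[OF Ek] mp_map_id mp_map_id]
    by (intro AE_pair_eqI) (auto elim: AE_mp)
  from AE_pair_nested(2)[OF this] show thesis by (rule that)
qed

theorem ergodic_product:
  assumes eigen: "\<And>F C. F \<in> borel_measurable M \<Longrightarrow> (\<And>x. cmod (F x) \<le> C) \<Longrightarrow>
      (\<And>T. T \<in> \<T> \<Longrightarrow> \<exists>z. AE x in M. F (T x) = z * F x) \<Longrightarrow> \<exists>c. AE x in M. F x = c"
    and A: "A \<in> sets (M \<Otimes>\<^sub>M M)"
    and inv: "\<And>T. T \<in> \<T> \<Longrightarrow> AE w in M \<Otimes>\<^sub>M M. map_prod T T w \<in> A \<longleftrightarrow> w \<in> A"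
  shows "measure (M \<Otimes>\<^sub>M M) A = 0 \<or> measure (M \<Otimes>\<^sub>M M) A = 1"
proof -
  interpret P: pair_prob_space M M ..
  let ?N = "M \<Otimes>\<^sub>M M"
  define I :: "'a \<Rightarrow> 'a \<Rightarrow> complex" where "I x y = indicator A (x, y)" for x y
  have case_I: "case_prod I = indicator A" by (auto simp: I_def fun_eq_iff)
  have Ik: "I \<in> kernels M"
    using A sets.sets_into_space[OF A] unfolding kernels_def
    by (auto simp: case_I I_def indicator_def space_pair_measure intro!: exI[of _ 1])
  have I_inv: "invariant_kernel M T I" if "T \<in> \<T>" for T
    unfolding invariant_kernel_def using inv[OF that]
    by eventually_elim (auto simp: I_def indicator_def map_prod_def split_beta)
  \<comment> \<open>The row integrals are invariant, an eigenfunction with eigenvalue 1, hence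
    almost everywhere a constant c. Subtracting c from the indicator makes K orthogonal to the
    constants on the right.\<close>
  define a where "a x = (LINT y|M. I x y)" for x
  have a_meas: "a \<in> borel_measurable M"
    unfolding a_def by (rule borel_measurable_lebesgue_integral[OF kernel_measurable[OF Ik]])
  have "\<exists>c. AE x in M. a x = c"
  proof (rule eigen[OF a_meas])
    show "cmod (a x) \<le> 1" for x
      unfolding a_def by (intro norm_integral_le_const) (auto simp: I_def indicator_def)
    fix T assume T: "T \<in> \<T>"
    have "AE x in M. AE z in M. I (T x) (T z) = I x z"
      using I_inv[OF T] unfolding invariant_kernel_def by (rule AE_pair_nested(1))
    then have "AE x in M. a (T x) = 1 * a x"
    proof eventually_elim
      case (elim x)
      have "a (T x) = (LINT z|M. I (T x) (T z))"
        unfolding a_def by (rule mp_map_integral[OF maps[OF T], symmetric]) (intro kernel_measurable_row[OF Ik], simp)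
      also have "\<dots> = a x" unfolding a_def
        using elim by (intro integral_cong_AE kernel_measurable_row[OF Ik] mp_map_measurable[OF maps[OF T]]) auto
      finally show ?case by simp
    qed
    then show "\<exists>z. AE x in M. a (T x) = z * a x" by blast
  qed
  then obtain c where c: "AE x in M. a x = c" by blast
  define K where "K x y = I x y - c * one_kernel M x y" for x y
  have Kk: "K \<in> kernels M" unfolding K_def by (intro kernel_diff kernel_scale Ik one_kernel_kernel)
  have K_inv: "invariant_kernel M T K" if T: "T \<in> \<T>" for T
    unfolding invariant_kernel_def using I_inv[OF T, unfolded invariant_kernel_def] AE_space
    by eventually_elim (auto simp: K_def one_kernel_def space_pair_measure mp_map_space[OF maps[OF T]])
  note Ks = kernel_star[OF Kk]
  \<comment> \<open>Self-adjointness turns the one-sided orthogonality of K into a two-sided one,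
    and power iteration asks for a self-adjoint kernel.\<close>
  let ?H = "conv M (star K) K"
  have "conv M K (one_kernel M) z y = (a z - c) * one_kernel M z y" for z y
  proof (cases "z \<in> space M \<and> y \<in> space M")
    case True
    have "(LINT x|M. K z x) = (LINT x|M. I z x - c)"
      using True by (intro Bochner_Integration.integral_cong) (auto simp: K_def one_kernel_def)
    also have "\<dots> = a z - c"
    proof -
      have "integrable M (I z)"
        using kernel_row_square_integrable(2)[OF Ik, of z]
        by (rule integrable_bounded[where C=1]) (simp add: I_def indicator_def)
      then show ?thesis by (simp add: a_def prob_space)
    qed
    finally show ?thesis using True by (simp add: conv_one_kernel_right) (simp add: one_kernel_def)
  next
    case False
    then show ?thesis using kernel_outside[OF kernel_conv[OF Kk one_kernel_kernel], of z y] by (auto simp: one_kernel_def)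
  qed
  then have "conv M (star K) (conv M K (one_kernel M)) x y = (LINT z|M. star K x z * ((a z - c) * one_kernel M z y))" for x y
    by (simp add: conv_def)
  also have "(LINT z|M. star K x z * ((a z - c) * one_kernel M z y)) = 0" for x y
    by (rule integral_eq_zero_AE) (use c in \<open>eventually_elim, simp\<close>)
  finally have H1: "conv M ?H (one_kernel M) = (\<lambda>x y. 0)"
    by (auto simp: conv_assoc Kk Ks one_kernel_kernel)
  have Hs: "star ?H = ?H" by (simp add: star_conv)
  have "star (conv M ?H (one_kernel M)) = (\<lambda>x y. 0)" unfolding H1 by (simp add: star_def)
  then have H2: "conv M (one_kernel M) ?H = (\<lambda>x y. 0)" by (simp only: star_conv star_one_kernel Hs[unfolded star_conv])
  have Hk: "?H \<in> kernels M" by (intro kernel_conv Ks Kk)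
  have "?H \<in> invariant_kernels"
    using H1 H2 Hk by (auto simp: invariant_kernels_def intro!: invariant_conv Kk Ks maps K_inv invariant_star)
  moreover have "\<nexists>E. minimal_projection E"
  proof
    assume "\<exists>E. minimal_projection E"
    then obtain E where E: "minimal_projection E" by blast
    note EA = minimal_props[OF E] and Ek = kernel[OF minimal_props(1)[OF E]]
    have "\<exists>c. AE y in M. AE x in M. E (T x) y = c * E x y" if "T \<in> \<T>" for T
      using minimal_projection_translate[OF E that] by metis
    then have "\<forall>T\<in>\<T>. \<exists>c. AE y in M. AE x in M. E (T x) y = c * E x y" by blast
    from bchoice[OF this] obtain z where "\<forall>T\<in>\<T>. AE y in M. AE x in M. E (T x) y = z T * E x y" by blast
    \<comment> \<open>The scalar for T does not depend on y, and there are countably many T, so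
      almost every column is a joint eigenfunction of all the maps.\<close>
    then have "AE y in M. \<forall>T\<in>\<T>. AE x in M. E (T x) y = z T * E x y"
      using maps_countable by (simp add: AE_ball_countable)
    then have "AE y in M. AE x in M. E x y = 0"
      using AE_space
    proof eventually_elim
      case (elim y)
      obtain C where C: "\<And>x y. cmod (E x y) \<le> C" using kernel_bound[OF Ek] by metis
      have "\<exists>c. AE x in M. E x y = c"
      proof (rule eigen)
        show "(\<lambda>x. E x y) \<in> borel_measurable M" by (intro kernel_measurable_col[OF Ek]) simp
        show "cmod (E x y) \<le> C" for x by (rule C)
      qed (use elim(1) in blast)
      then obtain d where d: "AE x in M. E x y = d" by blast
      have "(LINT x|M. E x y) = (LINT x|M. d)"
        using d by (intro integral_cong_AE kernel_measurable_col[OF Ek]) auto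
      then have "d = (LINT x|M. E x y)" by (simp add: prob_space)
      also have "\<dots> = conv M (one_kernel M) E y y" by (simp add: conv_one_kernel_left elim)
      also have "\<dots> = 0" using EA(1) by (simp add: invariant_kernels_def)
      finally show ?case using d by simp
    qed
    then have "AE y in M. AE x in M. (cmod (star E y x))\<^sup>2 = 0" by (simp add: star_def)
    then have "AE y in M. (LINT x|M. (cmod (star E y x))\<^sup>2) = 0"
      by eventually_elim (rule integral_eq_zero_AE)
    then have "hs M (star E) = 0" unfolding hs_def by (rule integral_eq_zero_AE)
    then show False using E by (simp add: EA(2) minimal_projection_def)
  qed
  ultimately have "\<not> hs M (conv M ?H ?H) > 0"
    using minimal_projection_exists[OF _ Hs] by blast
  \<comment> \<open>Cancellation is used twice: first for \<open>?H\<close>, which is its own star,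
    then for K, since \<open>?H\<close> is \<open>star K\<close> composed with K.\<close>
  then have "hs M (conv M (star ?H) ?H) = 0" using hs_nonneg[of "conv M ?H ?H"] by (simp add: Hs)
  then have "hs M ?H = 0" by (rule hs_eq_0_if_star_conv[OF Hk])
  then have "hs M K = 0" by (rule hs_eq_0_if_star_conv[OF Kk])
  then have "AE w in ?N. case_prod K w = 0" by (simp add: hs_eq_0_iff[OF Kk])
  then have ic: "AE w in ?N. indicator A w = c"
    using AE_space by eventually_elim (auto simp: K_def I_def one_kernel_def space_pair_measure)
  show ?thesis
  proof (cases "c = 0")
    case True
    then have "AE w in ?N. w \<notin> A" using ic by (auto elim!: AE_mp simp: indicator_def)
    then show ?thesis using A by (simp add: P.prob_eq_0)
  next
    case False
    then have "AE w in ?N. w \<in> A" using ic by (auto elim!: AE_mp simp: indicator_def)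
    then show ?thesis using A by (simp add: P.prob_eq_1)
  qed
qed

end

subsection \<open>Pretentious distances\<close>

lemma infsum_ennreal_less_top_iff:
  fixes f :: "'b \<Rightarrow> real"
  assumes nonneg: "\<And>x. x \<in> A \<Longrightarrow> f x \<ge> 0"
  shows "(\<Sum>\<^sub>\<infinity>x\<in>A. ennreal (f x)) < \<infinity> \<longleftrightarrow> f summable_on A"
proof -
  have sup: "(\<Sum>\<^sub>\<infinity>x\<in>A. ennreal (f x)) = (SUP F\<in>{F. finite F \<and> F \<subseteq> A}. (\<Sum>x\<in>F. ennreal (f x)))"
    by (rule nonneg_infsum_complete) simp
  have fin: "(\<Sum>x\<in>F. ennreal (f x)) = ennreal (sum f F)" if "F \<subseteq> A" for F
    using that nonneg by (intro sum_ennreal) auto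
  show ?thesis
  proof
    assume "f summable_on A"
    then have "ennreal (infsum f A) = (SUP F\<in>{F. finite F \<and> F \<subseteq> A}. ennreal (sum f F))"
      using nonneg by (intro infsum_nonneg_is_SUPREMUM_ennreal) auto
    also have "\<dots> = (\<Sum>\<^sub>\<infinity>x\<in>A. ennreal (f x))" unfolding sup by (intro SUP_cong) (auto simp: fin)
    finally show "(\<Sum>\<^sub>\<infinity>x\<in>A. ennreal (f x)) < \<infinity>" by (metis ennreal_less_top infinity_ennreal_def)
  next
    assume "(\<Sum>\<^sub>\<infinity>x\<in>A. ennreal (f x)) < \<infinity>"
    then obtain r where r: "(\<Sum>\<^sub>\<infinity>x\<in>A. ennreal (f x)) = ennreal r" "r \<ge> 0"
      by (metis ennreal_cases infinity_ennreal_def less_irrefl)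
    show "f summable_on A"
    proof (rule nonneg_bdd_above_summable_on)
      show "bdd_above (sum f ` {F. F \<subseteq> A \<and> finite F})"
      proof (rule bdd_aboveI2)
        fix F assume F: "F \<in> {F. F \<subseteq> A \<and> finite F}"
        then have "ennreal (sum f F) \<le> ennreal r"
          unfolding r(1)[symmetric] sup by (subst fin[symmetric]) (auto intro!: SUP_upper)
        then show "sum f F \<le> r" using r(2) by simp
      qed
    qed (rule nonneg)
  qed
qed

lemma ennreal_sqrt_less_top_iff: "ennreal_sqrt x < \<infinity> \<longleftrightarrow> x < \<infinity>"
  by (auto simp: ennreal_sqrt_def less_top)

lemma L2_nrm_square: "(L2_nrm M F)\<^sup>2 = (LINT x|M. (cmod (F x))\<^sup>2)"
  unfolding L2_nrm_def by (intro real_sqrt_pow2 integral_nonneg_AE AE_I2) simp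

lemma fun_dist_less_top_iff:
  "fun_dist M R f F < \<infinity> \<longleftrightarrow>
     (\<lambda>p. (LINT x|M. (cmod (F (R p x) - f p * F x))\<^sup>2) / real p) summable_on {p. prime p}"
proof -
  have "fun_dist M R f F < \<infinity> \<longleftrightarrow> (\<Sum>\<^sub>\<infinity>p\<in>{p. prime p}.
        ennreal ((LINT x|M. (cmod (F (R p x) - f p * F x))\<^sup>2) / real p)) < \<infinity>"
    unfolding fun_dist_def ennreal_sqrt_less_top_iff L2_nrm_square
    by (simp add: ennreal_mult_eq_top_iff ennreal_divide_eq_top_iff ennreal_divide_eq_0_iff less_top[symmetric])
  then show ?thesis
    by (subst (asm) infsum_ennreal_less_top_iff) (auto intro!: divide_nonneg_nonneg integral_nonneg_AE)
qed

text \<open>For unimodular values the squared difference is 2 (1 - Re (f cnj g)). This brings the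
  distance of two functions into the same form as the distance of an eigenfunction to f.\<close>

lemma mult_dist_less_top_iff:
  assumes f: "\<And>p. prime p \<Longrightarrow> cmod (f p) = 1" and g: "\<And>p. prime p \<Longrightarrow> cmod (g p) = 1"
  shows "mult_dist f g < \<infinity> \<longleftrightarrow> (\<lambda>p. (cmod (f p - g p))\<^sup>2 / real p) summable_on {p. prime p}"
proof -
  have eq: "(cmod (f p - g p))\<^sup>2 = 2 * (1 - Re (f p * cnj (g p)))" if "prime p" for p
  proof -
    have "(cmod (f p - g p))\<^sup>2 = (cmod (f p))\<^sup>2 + (cmod (g p))\<^sup>2 - 2 * Re (f p * cnj (g p))"
      unfolding cmod_power2 by (simp add: power2_eq_square algebra_simps)
    then show ?thesis using f[OF that] g[OF that] by simp
  qed
  have nonneg: "1 - Re (f p * cnj (g p)) \<ge> 0" if "prime p" for p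
  proof -
    have "0 \<le> 2 * (1 - Re (f p * cnj (g p)))" unfolding eq[OF that, symmetric] by simp
    then show ?thesis by (simp only: zero_le_mult_iff) simp
  qed
  have "mult_dist f g < \<infinity> \<longleftrightarrow> (\<lambda>p. (1 - Re (f p * cnj (g p))) / real p) summable_on {p. prime p}"
    unfolding mult_dist_def ennreal_sqrt_less_top_iff
  proof (rule infsum_ennreal_less_top_iff)
    fix p :: nat assume "p \<in> {p. prime p}"
    then have "0 \<le> 1 - Re (f p * cnj (g p))" by (intro nonneg) simp
    then show "0 \<le> (1 - Re (f p * cnj (g p))) / real p" by (rule divide_nonneg_nonneg) simp
  qed
  also have "\<dots> \<longleftrightarrow> (\<lambda>p. 2 * ((1 - Re (f p * cnj (g p))) / real p)) summable_on {p. prime p}"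
    by (rule summable_on_cmult_right'[symmetric]) simp
  also have "\<dots> \<longleftrightarrow> (\<lambda>p. (cmod (f p - g p))\<^sup>2 / real p) summable_on {p. prime p}"
    by (intro summable_on_cong) (simp add: eq)
  finally show ?thesis .
qed

lemma comp_mult_extension:
  fixes z :: "nat \<Rightarrow> complex"
  assumes "\<And>p. prime p \<Longrightarrow> cmod (z p) = 1"
  obtains f where "f \<in> comp_mult" "\<And>p. prime p \<Longrightarrow> f p = z p"
proof
  let ?f = "\<lambda>n. prod_mset (image_mset z (prime_factorization n))"
  have "cmod (prod_mset (image_mset z A)) = 1" if "\<And>p. p \<in># A \<Longrightarrow> prime p" for A
    using that by (induction A) (auto simp: norm_mult assms)
  then have "cmod (?f n) = 1" for n by (auto intro: in_prime_factors_imp_prime)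
  then show "?f \<in> comp_mult" by (auto simp: comp_mult_def prime_factorization_mult)
  show "?f p = z p" if "prime p" for p using that by (simp add: prime_factorization_prime)
qed

section \<open>Big and small primes\<close>

definition prime_class :: "(nat \<Rightarrow> 'k) \<Rightarrow> nat \<Rightarrow> nat set" where
  "prime_class \<kappa> p = {q. prime q \<and> \<kappa> q = \<kappa> p}"

text \<open>The label \<open>\<kappa> q\<close> stands for the map at q. Since labels are separate
  from maps, a system and its square can carry the same labels and so have the same big
  primes.\<close>

definition big :: "(nat \<Rightarrow> 'k) \<Rightarrow> nat \<Rightarrow> bool" where
  "big \<kappa> p \<longleftrightarrow> prime p \<and> \<not> (\<lambda>q. 1 / real q) summable_on prime_class \<kappa> p"

lemma big_cong: "prime p \<Longrightarrow> prime q \<Longrightarrow> \<kappa> p = \<kappa> q \<Longrightarrow> big \<kappa> p \<longleftrightarrow> big \<kappa> q"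
  by (simp add: big_def prime_class_def)

text \<open>A positive d would let a multiple of \<open>h q / real q\<close> dominate 1/q on the
  class, whose reciprocal sum diverges. In particular a nonnegative h that is constant on the class
  of a big prime vanishes there.\<close>

lemma big_lower_bound:
  assumes big: "big \<kappa> p" and sum: "(\<lambda>q. h q / real q) summable_on {q. prime q}"
    and le: "\<And>q. q \<in> prime_class \<kappa> p \<Longrightarrow> d \<le> h q"
  shows "d \<le> 0"
proof (rule ccontr)
  assume "\<not> d \<le> 0"
  then have d: "d > 0" by simp
  have "(\<lambda>q. (1 / d) * (h q / real q)) summable_on prime_class \<kappa> p"
    by (intro summable_on_cmult_right summable_on_subset[OF sum]) (auto simp: prime_class_def)
  then have "(\<lambda>q. 1 / real q) summable_on prime_class \<kappa> p"
  proof (rule summable_on_comparison_test)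
    fix q assume q: "q \<in> prime_class \<kappa> p"
    have "d * (1 / real q) \<le> h q * (1 / real q)" using le[OF q] by (intro mult_right_mono) auto
    moreover have "real q > 0" using q prime_gt_0_nat by (simp add: prime_class_def)
    ultimately show "1 / real q \<le> (1 / d) * (h q / real q)" using d by (simp add: field_simps)
  qed simp
  then show False using big by (simp add: big_def)
qed

text \<open>The small primes lie in finitely many classes, one for each label, and each class that
  contains a small prime has convergent reciprocal sum.\<close>

lemma summable_on_non_big:
  assumes "finite (\<kappa> ` {p. prime p})"
  shows "(\<lambda>q. 1 / real q) summable_on {p. prime p \<and> \<not> big \<kappa> p}"
proof -
  have "(\<lambda>q. 1 / real q) summable_on (\<Union>k\<in>K. {q. prime q \<and> \<kappa> q = k \<and> \<not> big \<kappa> q})"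
    if "finite K" for K
    using that
  proof induction
    case (insert k K)
    have "(\<lambda>q. 1 / real q) summable_on {q. prime q \<and> \<kappa> q = k \<and> \<not> big \<kappa> q}"
    proof (cases "{q. prime q \<and> \<kappa> q = k \<and> \<not> big \<kappa> q} = {}")
      case True
      show ?thesis unfolding True by simp
    next
      case False
      then obtain p where "prime p" "\<kappa> p = k" "\<not> big \<kappa> p" by blast
      then have "(\<lambda>q. 1 / real q) summable_on prime_class \<kappa> p" by (simp add: big_def)
      then show ?thesis by (rule summable_on_subset) (use \<open>\<kappa> p = k\<close> in \<open>auto simp: prime_class_def\<close>)
    qed
    then show ?case using insert by (simp add: summable_on_union)
  qed simp
  from this[OF assms] show ?thesis by (rule summable_on_subset) auto
qed

locale finitely_many_maps = prob_space M for M :: "'a measure" +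
  fixes R :: "nat \<Rightarrow> 'a \<Rightarrow> 'a" and \<kappa> :: "nat \<Rightarrow> 'k"
  assumes maps_mp: "prime p \<Longrightarrow> mp_map M (R p)"
    and same_map: "\<lbrakk>prime p; prime q; \<kappa> p = \<kappa> q; x \<in> space M\<rbrakk> \<Longrightarrow> R p x = R q x"
    and finite_keys: "finite (\<kappa> ` {p. prime p})"
begin

text \<open>No multiplicative f appears: the small primes contribute a finite sum whatever f is, so
  only the maps at big primes matter, and f is rebuilt from the eigenvalues afterwards.\<close>

definition joint_eigenfunction :: "('a \<Rightarrow> complex) \<Rightarrow> bool" where
  "joint_eigenfunction F \<longleftrightarrow> F \<in> L2 M \<and> (\<forall>p. big \<kappa> p \<longrightarrow> (\<exists>z. AE x in M. F (R p x) = z * F x))"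

lemma L2_measurable: "F \<in> L2 M \<Longrightarrow> F \<in> borel_measurable M"
  and L2_integrable: "F \<in> L2 M \<Longrightarrow> integrable M (\<lambda>x. (cmod (F x))\<^sup>2)"
  by (auto simp: L2_def)

lemma L2_compose:
  assumes F: "F \<in> L2 M" and T: "mp_map M T"
  shows "(\<lambda>x. F (T x)) \<in> L2 M"
proof -
  have Tm: "T \<in> M \<rightarrow>\<^sub>M M" and Td: "distr M M T = M" using T by (auto simp: mp_map_def)
  have "integrable (distr M M T) (\<lambda>x. (cmod (F x))\<^sup>2)" unfolding Td by (rule L2_integrable[OF F])
  then have "integrable M (\<lambda>x. (cmod (F (T x)))\<^sup>2)" by (rule integrable_distr[OF Tm])
  then show ?thesis using measurable_compose[OF Tm L2_measurable[OF F]] by (simp add: L2_def)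
qed

lemma L2_bounded:
  assumes "F \<in> borel_measurable M" "\<And>x. cmod (F x) \<le> C"
  shows "F \<in> L2 M"
proof -
  have "integrable M (\<lambda>x. (cmod (F x))\<^sup>2)"
    using assms by (intro integrable_bounded[where C="C\<^sup>2"]) (auto intro!: power_mono)
  then show ?thesis using assms by (simp add: L2_def)
qed

text \<open>Shows the squared distance as a polynomial in the real and imaginary parts of w, hence
  continuous, so that it has a minimum on the unit circle.\<close>

lemma norm_diff_square_expand:
  assumes F: "F \<in> L2 M" and G: "G \<in> L2 M"
  shows "(LINT x|M. (cmod (G x - w * F x))\<^sup>2) =
     (LINT x|M. (cmod (G x))\<^sup>2) - 2 * Re (cnj w * (LINT x|M. G x * cnj (F x))) + (cmod w)\<^sup>2 * (LINT x|M. (cmod (F x))\<^sup>2)"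
    and "integrable M (\<lambda>x. (cmod (G x - w * F x))\<^sup>2)"
proof -
  have GF: "integrable M (\<lambda>x. G x * cnj (F x))"
    using L2_integrable[OF F] L2_integrable[OF G] L2_measurable[OF F] L2_measurable[OF G]
    by (intro cauchy_schwarz_integral(1)) auto
  have eq: "(cmod (G x - w * F x))\<^sup>2 = (cmod (G x))\<^sup>2 - 2 * Re (cnj w * (G x * cnj (F x))) + (cmod w)\<^sup>2 * (cmod (F x))\<^sup>2" for x
    unfolding cmod_power2 by (simp add: power2_eq_square algebra_simps)
  have i1: "integrable M (\<lambda>x. Re (cnj w * (G x * cnj (F x))))"
    using GF by (intro integrable_Re integrable_mult_right) auto
  have i2: "(LINT x|M. Re (cnj w * (G x * cnj (F x)))) = Re (cnj w * (LINT x|M. G x * cnj (F x)))"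
    using GF by (subst integral_Re) auto
  show "integrable M (\<lambda>x. (cmod (G x - w * F x))\<^sup>2)"
    unfolding eq using L2_integrable[OF F] L2_integrable[OF G] i1 by (intro Bochner_Integration.integrable_add Bochner_Integration.integrable_diff integrable_mult_right) auto
  show "(LINT x|M. (cmod (G x - w * F x))\<^sup>2) =
     (LINT x|M. (cmod (G x))\<^sup>2) - 2 * Re (cnj w * (LINT x|M. G x * cnj (F x))) + (cmod w)\<^sup>2 * (LINT x|M. (cmod (F x))\<^sup>2)"
  proof -
    define h where "h x = Re (cnj w * (G x * cnj (F x)))" for x
    have "integrable M h" unfolding h_def by (rule i1)
    then show ?thesis
      unfolding eq i2[symmetric] h_def[symmetric] using L2_integrable[OF F] L2_integrable[OF G] by simp
  qed
qed

lemma norm_diff_square_eq_0: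
  assumes F: "F \<in> L2 M" and G: "G \<in> L2 M" and z: "(LINT x|M. (cmod (G x - w * F x))\<^sup>2) \<le> 0"
  shows "AE x in M. G x = w * F x"
proof -
  have "(LINT x|M. (cmod (G x - w * F x))\<^sup>2) = 0"
    using z by (intro antisym) (auto intro!: integral_nonneg_AE)
  then have "AE x in M. (cmod (G x - w * F x))\<^sup>2 = 0"
    using integral_nonneg_eq_0_iff_AE[OF norm_diff_square_expand(2)[OF F G]] by simp
  then show ?thesis by eventually_elim simp
qed

lemma class_integral_eq:
  assumes "prime p" "q \<in> prime_class \<kappa> p"
  shows "(LINT x|M. (cmod (F (R q x) - w * F x))\<^sup>2) = (LINT x|M. (cmod (F (R p x) - w * F x))\<^sup>2)"
  using assms same_map[of q p] by (intro Bochner_Integration.integral_cong) (auto simp: prime_class_def)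

lemma pret_space_iff:
  "F \<in> pret_space M R f \<longleftrightarrow> F \<in> L2 M \<and>
     (\<lambda>p. (LINT x|M. (cmod (F (R p x) - f p * F x))\<^sup>2) / real p) summable_on {p. prime p}"
  unfolding pret_space_def mem_Collect_eq fun_dist_less_top_iff ..

lemma pret_space_lower_bound:
  assumes F: "F \<in> pret_space M R f" and p: "big \<kappa> p"
    and le: "\<And>q. q \<in> prime_class \<kappa> p \<Longrightarrow> d \<le> (LINT x|M. (cmod (F (R p x) - f q * F x))\<^sup>2)"
  shows "d \<le> 0"
proof (rule big_lower_bound[OF p])
  show "(\<lambda>q. (LINT x|M. (cmod (F (R q x) - f q * F x))\<^sup>2) / real q) summable_on {q. prime q}"
    using F by (simp add: pret_space_iff)
  show "d \<le> (LINT x|M. (cmod (F (R q x) - f q * F x))\<^sup>2)" if "q \<in> prime_class \<kappa> p" for q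
    using le[OF that] p that by (simp add: class_integral_eq[of p q] big_def)
qed

text \<open>The distance from \<open>F \<circ> R p\<close> to \<open>w F\<close> attains its minimum over the unit circle, and divergence
  of the reciprocal sum over the class of \<open>p\<close> forces this minimum to vanish.\<close>

lemma pret_space_joint_eigenfunction:
  assumes F: "F \<in> pret_space M R f" and f: "\<And>p. prime p \<Longrightarrow> cmod (f p) = 1"
  shows "joint_eigenfunction F"
  unfolding joint_eigenfunction_def
proof (intro conjI allI impI)
  show FL: "F \<in> L2 M" using F by (simp add: pret_space_def)
  fix p assume p: "big \<kappa> p"
  then have GL: "(\<lambda>x. F (R p x)) \<in> L2 M" by (intro L2_compose[OF FL maps_mp]) (simp add: big_def)
  define g where "g w = (LINT x|M. (cmod (F (R p x) - w * F x))\<^sup>2)" for w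
  have "continuous_on (sphere 0 1) g"
    unfolding g_def norm_diff_square_expand(1)[OF FL GL] by (intro continuous_intros)
  then have "\<exists>z\<in>sphere 0 1. \<forall>w\<in>sphere 0 1. g z \<le> g w"
    by (intro continuous_attains_inf) auto
  then obtain z where z: "\<And>w. w \<in> sphere 0 1 \<Longrightarrow> g z \<le> g w" by blast
  have "g z \<le> 0"
  proof (rule pret_space_lower_bound[OF F p])
    fix q assume "q \<in> prime_class \<kappa> p"
    then have "g z \<le> g (f q)" by (intro z) (auto simp: prime_class_def f)
    then show "g z \<le> (LINT x|M. (cmod (F (R p x) - f q * F x))\<^sup>2)" by (simp add: g_def)
  qed
  then have "AE x in M. F (R p x) = z * F x" unfolding g_def by (rule norm_diff_square_eq_0[OF FL GL])
  then show "\<exists>z. AE x in M. F (R p x) = z * F x" ..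
qed

lemma pret_space_one_invariant:
  assumes F: "F \<in> pret_space M R one_fun" and p: "big \<kappa> p"
  shows "AE x in M. F (R p x) = F x"
proof -
  have FL: "F \<in> L2 M" using F by (simp add: pret_space_def)
  have GL: "(\<lambda>x. F (R p x)) \<in> L2 M" using p by (intro L2_compose[OF FL maps_mp]) (simp add: big_def)
  have "(LINT x|M. (cmod (F (R p x) - 1 * F x))\<^sup>2) \<le> 0"
    by (rule pret_space_lower_bound[OF F p]) simp
  from norm_diff_square_eq_0[OF FL GL this] show ?thesis by simp
qed

text \<open>Terms at big primes vanish. The others are at most 4 times the squared norm of F over p,
  because |u - v|^2 is at most 2|u|^2 + 2|v|^2 and the maps preserve norms; these bounds are
  summable over the small primes.\<close>

lemma pret_spaceI:
  assumes F: "F \<in> L2 M" and f: "\<And>p. prime p \<Longrightarrow> cmod (f p) = 1"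
    and eigen: "\<And>p. big \<kappa> p \<Longrightarrow> AE x in M. F (R p x) = f p * F x"
  shows "F \<in> pret_space M R f"
proof -
  define n where "n p = (LINT x|M. (cmod (F (R p x) - f p * F x))\<^sup>2)" for p
  define b where "b = (LINT x|M. (cmod (F x))\<^sup>2)"
  have bound: "n p \<le> 4 * b" if p: "prime p" for p
  proof -
    have GL: "(\<lambda>x. F (R p x)) \<in> L2 M" by (rule L2_compose[OF F maps_mp[OF p]])
    have "(LINT x|M. (cmod (F (R p x)))\<^sup>2) = b"
      unfolding b_def using L2_measurable[OF F] by (intro mp_map_integral maps_mp p) auto
    have "n p \<le> (LINT x|M. 2 * (cmod (F (R p x)))\<^sup>2 + 2 * (cmod (F x))\<^sup>2)"
      unfolding n_def
    proof (rule integral_mono)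
      show "integrable M (\<lambda>x. (cmod (F (R p x) - f p * F x))\<^sup>2)"
        by (rule norm_diff_square_expand(2)[OF F GL])
      show "integrable M (\<lambda>x. 2 * (cmod (F (R p x)))\<^sup>2 + 2 * (cmod (F x))\<^sup>2)"
        using L2_integrable[OF F] L2_integrable[OF GL] by simp
      fix x
      have "cmod (F (R p x) - f p * F x) \<le> cmod (F (R p x)) + cmod (F x)"
        using norm_triangle_ineq4[of "F (R p x)" "f p * F x"] f[OF p] by (simp add: norm_mult)
      then have "(cmod (F (R p x) - f p * F x))\<^sup>2 \<le> (cmod (F (R p x)) + cmod (F x))\<^sup>2"
        by (intro power_mono) auto
      also have "\<dots> \<le> 2 * (cmod (F (R p x)))\<^sup>2 + 2 * (cmod (F x))\<^sup>2"
        using sum_squares_bound[of "cmod (F (R p x))" "cmod (F x)"] by (simp add: power2_sum)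
      finally show "(cmod (F (R p x) - f p * F x))\<^sup>2 \<le> 2 * (cmod (F (R p x)))\<^sup>2 + 2 * (cmod (F x))\<^sup>2" .
    qed
    also have "\<dots> = 4 * b"
      using L2_integrable[OF F] L2_integrable[OF GL] \<open>(LINT x|M. (cmod (F (R p x)))\<^sup>2) = b\<close>
      by (simp add: b_def)
    finally show ?thesis .
  qed
  have n_nonneg: "n p \<ge> 0" for p unfolding n_def by (intro integral_nonneg_AE AE_I2) simp
  have zero: "n p = 0" if "big \<kappa> p" for p
    unfolding n_def by (rule integral_eq_zero_AE) (use eigen[OF that] in \<open>eventually_elim, simp\<close>)
  have "(\<lambda>p. 4 * b * (1 / real p)) summable_on {p. prime p \<and> \<not> big \<kappa> p}"
    by (intro summable_on_cmult_right summable_on_non_big finite_keys)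
  then have "(\<lambda>p. n p / real p) summable_on {p. prime p \<and> \<not> big \<kappa> p}"
  proof (rule summable_on_comparison_test)
    fix p assume "p \<in> {p. prime p \<and> \<not> big \<kappa> p}"
    then have "n p / real p \<le> 4 * b / real p" by (intro divide_right_mono bound) auto
    then show "n p / real p \<le> 4 * b * (1 / real p)" by simp
  qed (simp add: n_nonneg)
  then have "(\<lambda>p. n p / real p) summable_on {p. prime p}"
    by (subst summable_on_cong_neutral[where T="{p. prime p \<and> \<not> big \<kappa> p}" and g="\<lambda>p. n p / real p"])
      (auto simp: zero)
  then show ?thesis using F by (simp add: pret_space_iff n_def)
qed

lemma eigenvalue_unimodular:
  assumes F: "F \<in> L2 M" and nz: "\<not> (AE x in M. F x = 0)" and p: "prime p"
    and z: "AE x in M. F (R p x) = z * F x"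
  shows "cmod z = 1"
proof -
  have [measurable]: "F \<in> borel_measurable M" by (rule L2_measurable[OF F])
  have [measurable]: "R p \<in> M \<rightarrow>\<^sub>M M" using maps_mp[OF p] by (rule mp_map_measurable)
  have "(LINT x|M. (cmod (F x))\<^sup>2) = (LINT x|M. (cmod (F (R p x)))\<^sup>2)"
    by (rule mp_map_integral[OF maps_mp[OF p], symmetric]) measurable
  also have "\<dots> = (LINT x|M. (cmod z)\<^sup>2 * (cmod (F x))\<^sup>2)"
    using z by (intro integral_cong_AE) (auto simp: norm_mult power_mult_distrib)
  finally have "(1 - (cmod z)\<^sup>2) * (LINT x|M. (cmod (F x))\<^sup>2) = 0" by (simp add: algebra_simps)
  moreover have "(LINT x|M. (cmod (F x))\<^sup>2) \<noteq> 0"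
    using nz integral_nonneg_eq_0_iff_AE[OF L2_integrable[OF F]] by simp
  ultimately have "(cmod z)\<^sup>2 = 1\<^sup>2" by simp
  then show ?thesis by (subst (asm) power2_eq_iff_nonneg) auto
qed

text \<open>One eigenvalue is chosen for each label rather than for each prime, and 1 is used at
  small primes. Hence f takes finitely many values and is constant on each big class, which is what
  makes its distance to 1 decidable from the eigenvalues.\<close>

lemma joint_eigenfunction_pret_space:
  assumes F: "joint_eigenfunction F"
  obtains f where "f \<in> comp_mult_fg" "F \<in> pret_space M R f"
    "\<And>p. big \<kappa> p \<Longrightarrow> AE x in M. F (R p x) = f p * F x"
    "\<And>p q. big \<kappa> p \<Longrightarrow> q \<in> prime_class \<kappa> p \<Longrightarrow> f q = f p"
proof -
  have FL: "F \<in> L2 M" using F by (simp add: joint_eigenfunction_def)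
  define P where "P p z \<longleftrightarrow> cmod z = 1 \<and> (AE x in M. F (R p x) = z * F x)" for p z
  have ex: "\<exists>z. P p z" if p: "big \<kappa> p" for p
  proof (cases "AE x in M. F x = 0")
    \<comment> \<open>For a null function every scalar is an eigenvalue; 1 is a unimodular
      choice.\<close>
    case True
    have "AE x in M. F (R p x) = 0"
      using p by (intro mp_map_AE[OF maps_mp True]) (simp add: big_def)
    with True have "AE x in M. F (R p x) = 1 * F x" by eventually_elim simp
    then show ?thesis unfolding P_def using norm_one by blast
  next
    case False
    obtain z where z: "AE x in M. F (R p x) = z * F x" using F p unfolding joint_eigenfunction_def by blast
    then show ?thesis unfolding P_def using eigenvalue_unimodular[OF FL False _ z] p by (auto simp: big_def)
  qed
  have P_cong: "P p z \<longleftrightarrow> P q z" if "prime p" "prime q" "\<kappa> p = \<kappa> q" for p q z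
  proof -
    have "(AE x in M. F (R p x) = z * F x) \<longleftrightarrow> (AE x in M. F (R q x) = z * F x)"
      by (intro AE_cong) (simp add: same_map[OF that])
    then show ?thesis by (simp add: P_def)
  qed
  define Z where "Z k = (SOME z. \<exists>p. prime p \<and> \<kappa> p = k \<and> P p z)" for k
  have PZ: "P p (Z (\<kappa> p))" if p: "big \<kappa> p" for p
  proof -
    have pp: "prime p" using p by (simp add: big_def)
    have "\<exists>z q. prime q \<and> \<kappa> q = \<kappa> p \<and> P q z" using ex[OF p] pp by blast
    then have "\<exists>q. prime q \<and> \<kappa> q = \<kappa> p \<and> P q (Z (\<kappa> p))" unfolding Z_def by (rule someI_ex)
    then show ?thesis using P_cong[OF _ pp] by blast
  qed
  let ?z = "\<lambda>p. if big \<kappa> p then Z (\<kappa> p) else 1"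
  have "cmod (?z p) = 1" for p using PZ by (simp add: P_def)
  then obtain f where f: "f \<in> comp_mult" "\<And>p. prime p \<Longrightarrow> f p = ?z p"
    using comp_mult_extension[of ?z] by metis
  have "f ` {p. prime p} \<subseteq> insert 1 (Z ` \<kappa> ` {p. prime p})" using f(2) by auto
  then have "f \<in> comp_mult_fg"
    using f(1) finite_keys by (auto simp: comp_mult_fg_def intro: finite_subset)
  moreover have eigen: "AE x in M. F (R p x) = f p * F x" if "big \<kappa> p" for p
    using PZ[OF that] f(2)[of p] that by (simp add: P_def big_def)
  moreover have "F \<in> pret_space M R f"
    using f(1) eigen prime_ge_1_nat by (intro pret_spaceI FL) (auto simp: comp_mult_def)
  moreover have "f q = f p" if "big \<kappa> p" "q \<in> prime_class \<kappa> p" for p q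
    using that f(2)[of p] f(2)[of q] big_cong[of p q \<kappa>] by (simp add: prime_class_def big_def)
  ultimately show thesis using that[of f] by blast
qed

lemma eigenvalue_one_if_pretentious:
  assumes f: "f \<in> comp_mult" and dist: "mult_dist f one_fun < \<infinity>" and p: "big \<kappa> p"
    and const: "\<And>q. q \<in> prime_class \<kappa> p \<Longrightarrow> f q = f p"
  shows "f p = 1"
proof -
  have "(\<lambda>q. (cmod (f q - 1))\<^sup>2 / real q) summable_on {q. prime q}"
    using dist f prime_ge_1_nat by (subst (asm) mult_dist_less_top_iff) (auto simp: comp_mult_def)
  then have "(cmod (f p - 1))\<^sup>2 \<le> 0" by (rule big_lower_bound[OF p]) (simp add: const)
  then show ?thesis by simp
qed

text \<open>Membership of an indicator in the space of \<open>one_fun\<close> amounts to invariance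
  at big primes, so this is ordinary ergodicity of those maps.\<close>

lemma pretentiously_ergodic_iff:
  "pretentiously_ergodic M R \<longleftrightarrow>
     (\<forall>A\<in>sets M. (\<forall>p. big \<kappa> p \<longrightarrow> (AE x in M. R p x \<in> A \<longleftrightarrow> x \<in> A)) \<longrightarrow> measure M A = 0 \<or> measure M A = 1)"
proof -
  have "indicator A \<in> pret_space M R one_fun \<longleftrightarrow> (\<forall>p. big \<kappa> p \<longrightarrow> (AE x in M. R p x \<in> A \<longleftrightarrow> x \<in> A))"
    if A: "A \<in> sets M" for A
  proof
    assume *: "indicator A \<in> pret_space M R one_fun"
    show "\<forall>p. big \<kappa> p \<longrightarrow> (AE x in M. R p x \<in> A \<longleftrightarrow> x \<in> A)"
    proof (intro allI impI)
      fix p assume "big \<kappa> p"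
      from pret_space_one_invariant[OF * this] show "AE x in M. R p x \<in> A \<longleftrightarrow> x \<in> A"
        by eventually_elim (auto simp: indicator_def split: if_splits)
    qed
  next
    assume *: "\<forall>p. big \<kappa> p \<longrightarrow> (AE x in M. R p x \<in> A \<longleftrightarrow> x \<in> A)"
    show "indicator A \<in> pret_space M R one_fun"
    proof (rule pret_spaceI)
      show "indicator A \<in> L2 M" using A by (intro L2_bounded[where C=1]) (auto simp: indicator_def)
      show "AE x in M. (indicator A (R p x) :: complex) = 1 * indicator A x" if "big \<kappa> p" for p
        using *[rule_format, OF that] by eventually_elim (simp add: indicator_def)
    qed simp
  qed
  then show ?thesis unfolding pretentiously_ergodic_def by blast
qed

text \<open>All sublevel sets are invariant, hence null or of full measure. Rational levels suffice
  to separate real values and cost only one null set; off it, g cannot be told apart from its value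
  at one reference point.\<close>

lemma ergodic_invariant_real_constant:
  assumes erg: "pretentiously_ergodic M R" and g: "(g :: 'a \<Rightarrow> real) \<in> borel_measurable M"
    and inv: "\<And>p. big \<kappa> p \<Longrightarrow> AE x in M. g (R p x) = g x"
  shows "\<exists>c. AE x in M. g x = c"
proof -
  define A where "A r = {x \<in> space M. g x \<le> r}" for r
  have A: "A r \<in> sets M" for r unfolding A_def using g by measurable
  have "measure M (A r) = 0 \<or> measure M (A r) = 1" for r
  proof -
    have "AE x in M. R p x \<in> A r \<longleftrightarrow> x \<in> A r" if p: "big \<kappa> p" for p
      using inv[OF p] AE_space mp_map_AE[OF maps_mp AE_space, of p] p
      by (auto simp: A_def big_def)
    then show ?thesis using erg A unfolding pretentiously_ergodic_iff by blast
  qed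
  then have level: "AE x in M. x \<in> A r \<longleftrightarrow> measure M (A r) = 1" for r
    using A[of r] prob_eq_0[of "A r"] prob_eq_1[of "A r"] by (smt (verit, best) AE_cong)
  have "AE x in M. \<forall>r\<in>\<rat>. x \<in> A r \<longleftrightarrow> measure M (A r) = 1"
    using level by (simp add: AE_ball_countable countable_rat)
  then have lv: "AE x in M. x \<in> space M \<and> (\<forall>r\<in>\<rat>. x \<in> A r \<longleftrightarrow> measure M (A r) = 1)"
    using AE_space by eventually_elim simp
  then obtain x0 where x0: "x0 \<in> space M" "\<And>r. r \<in> \<rat> \<Longrightarrow> x0 \<in> A r \<longleftrightarrow> measure M (A r) = 1"
    using AE_E_prob by (smt (verit) eventually_happens' ae_filter_eq_bot_iff emeasure_space_1 zero_neq_one)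
  from lv have "AE x in M. g x = g x0"
  proof eventually_elim
    case (elim x)
    then have eq: "g x \<le> r \<longleftrightarrow> g x0 \<le> r" if "r \<in> \<rat>" for r using that x0 by (auto simp: A_def)
    show ?case
    proof (rule ccontr)
      assume "g x \<noteq> g x0"
      then consider "g x < g x0" | "g x0 < g x" by linarith
      then show False using eq Rats_dense_in_real by (cases; force)
    qed
  qed
  then show ?thesis ..
qed

lemma ergodic_invariant_constant:
  assumes erg: "pretentiously_ergodic M R" and F: "F \<in> borel_measurable M"
    and inv: "\<And>p. big \<kappa> p \<Longrightarrow> AE x in M. F (R p x) = F x"
  shows "AE_constant M F"
proof -
  have "\<exists>c. AE x in M. Re (F x) = c"
  proof (rule ergodic_invariant_real_constant[OF erg])
    show "AE x in M. Re (F (R p x)) = Re (F x)" if "big \<kappa> p" for p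
      using inv[OF that] by eventually_elim simp
  qed (use F in measurable)
  moreover have "\<exists>c. AE x in M. Im (F x) = c"
  proof (rule ergodic_invariant_real_constant[OF erg])
    show "AE x in M. Im (F (R p x)) = Im (F x)" if "big \<kappa> p" for p
      using inv[OF that] by eventually_elim simp
  qed (use F in measurable)
  ultimately obtain c d where "AE x in M. Re (F x) = c" "AE x in M. Im (F x) = d" by blast
  then have "AE x in M. F x = Complex c d" by eventually_elim (simp add: complex_eq_iff)
  then show ?thesis unfolding AE_constant_def ..
qed

end

subsection \<open>Finitely generated multiplicative systems\<close>

locale finitely_generated_system = multiplicative_system M S
  for M :: "'a::metric_space measure" and S :: "nat \<Rightarrow> 'a \<Rightarrow> 'a" +
  assumes fin_gen: "finitely_generated M S"
begin

text \<open>Restriction forgets the values off the carrier, so that equal labels mean equal maps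
  where it matters and the labels are finitely many.\<close>

definition key :: "nat \<Rightarrow> 'a \<Rightarrow> 'a" where
  "key p = restrict (S p) (space M)"

lemma S_mp_map: "n \<ge> 1 \<Longrightarrow> mp_map M (S n)"
  using measure_preserving by (simp add: mp_map_def)

lemma key_eq: "key p = key q \<Longrightarrow> x \<in> space M \<Longrightarrow> S p x = S q x"
  unfolding key_def by (metis restrict_apply')

sublocale finitely_many_maps M S key
proof
  show "finite (key ` {p. prime p})"
    using fin_gen by (simp add: finitely_generated_def key_def)
qed (auto intro: S_mp_map prime_ge_1_nat key_eq)

sublocale square: finitely_many_maps "M \<Otimes>\<^sub>M M" "\<lambda>n. map_prod (S n) (S n)" key
proof -
  interpret P: pair_prob_space M M ..
  show "finitely_many_maps (M \<Otimes>\<^sub>M M) (\<lambda>n. map_prod (S n) (S n)) key"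
    by standard (auto intro: mp_map_pair maps_mp finite_keys key_eq simp: space_pair_measure)
qed

section \<open>Each of the four conditions as triviality of the joint eigenfunctions\<close>

definition trivial_eigenfunctions :: bool where
  "trivial_eigenfunctions \<longleftrightarrow> (\<forall>F. joint_eigenfunction F \<longrightarrow> AE_constant M F)"

lemma trivial_if_weak_mixing:
  assumes wm: "pretentiously_weak_mixing M S"
  shows trivial_eigenfunctions
  unfolding trivial_eigenfunctions_def
proof (intro allI impI)
  fix F assume F: "joint_eigenfunction F"
  then have FL: "F \<in> L2 M" by (simp add: joint_eigenfunction_def)
  have Fm: "F \<in> borel_measurable M" by (rule L2_measurable[OF FL])
  show "AE_constant M F"
  proof (cases "AE x in M. F x = 0")
    case True
    then show ?thesis unfolding AE_constant_def ..
  next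
    case False
    define H where "H w = F (fst w) * cnj (F (snd w))" for w
    have Hm: "H \<in> borel_measurable (M \<Otimes>\<^sub>M M)" unfolding H_def using Fm by measurable
    have "AE_constant (M \<Otimes>\<^sub>M M) H"
    proof (rule square.ergodic_invariant_constant[OF _ Hm])
      show "pretentiously_ergodic (M \<Otimes>\<^sub>M M) (\<lambda>n. map_prod (S n) (S n))"
        using wm by (simp add: pretentiously_weak_mixing_def)
      fix p assume p: "big key p"
      then have pp: "prime p" by (simp add: big_def)
      have Sm: "S p \<in> M \<rightarrow>\<^sub>M M" by (rule mp_map_measurable[OF maps_mp[OF pp]])
      obtain z where z: "AE x in M. F (S p x) = z * F x" using F p by (auto simp: joint_eigenfunction_def)
      have "cmod z = 1" by (rule eigenvalue_unimodular[OF FL False pp z])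
      then have zz: "z * cnj z = 1" by (simp add: complex_norm_square[symmetric])
      have "AE w in M \<Otimes>\<^sub>M M. F (S p (fst w)) * cnj (F (S p (snd w))) = F (fst w) * cnj (F (snd w))"
      proof (rule AE_pair_eqI)
        show "AE x in M. AE y in M. F (S p x) * cnj (F (S p y)) = F x * cnj (F y)"
          using z
        proof eventually_elim
          case (elim x)
          from z show ?case
          proof eventually_elim
            case (elim y)
            have "F (S p x) * cnj (F (S p y)) = (z * cnj z) * (F x * cnj (F y))"
              using \<open>F (S p x) = z * F x\<close> elim by simp
            then show ?case by (simp add: zz)
          qed
        qed
      qed (use Fm Sm in measurable)
      then show "AE w in M \<Otimes>\<^sub>M M. H (map_prod (S p) (S p) w) = H w" by (simp add: H_def)
    qed
    then obtain c where "AE w in M \<Otimes>\<^sub>M M. F (fst w) * cnj (F (snd w)) = c"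
      unfolding AE_constant_def H_def by blast
    from AE_pair_nested(2)[OF this] have c: "AE y in M. AE x in M. F x * cnj (F y) = c" .
    \<comment> \<open>A column through a point with F y nonzero determines F up to the factor
      \<open>cnj (F y)\<close>, which can be divided out.\<close>
    obtain y where y: "F y \<noteq> 0" "AE x in M. F x * cnj (F y) = c"
    proof -
      have "\<exists>y. F y \<noteq> 0 \<and> (AE x in M. F x * cnj (F y) = c)"
      proof (rule ccontr)
        assume *: "\<not> ?thesis"
        from c have "AE y in M. F y = 0" by eventually_elim (use * in blast)
        with False show False ..
      qed
      then show thesis using that by blast
    qed
    from y(2) have "AE x in M. F x = c / cnj (F y)"
      by eventually_elim (use y(1) in \<open>simp add: field_simps\<close>)
    then show ?thesis unfolding AE_constant_def ..
  qed
qed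

lemma weak_mixing_if_trivial:
  assumes triv: trivial_eigenfunctions
  shows "pretentiously_weak_mixing M S"
  unfolding pretentiously_weak_mixing_def square.pretentiously_ergodic_iff
proof (intro ballI impI)
  fix A assume A: "A \<in> sets (M \<Otimes>\<^sub>M M)"
    and inv: "\<forall>p. big key p \<longrightarrow> (AE w in M \<Otimes>\<^sub>M M. map_prod (S p) (S p) w \<in> A \<longleftrightarrow> w \<in> A)"
  interpret T: commuting_maps M "S ` {p. big key p}"
  proof
    fix T U x assume "T \<in> S ` {p. big key p}" "U \<in> S ` {p. big key p}" "x \<in> space M"
    then show "T (U x) = U (T x)" using commuting prime_ge_1_nat by (auto simp: big_def)
  qed (auto simp: big_def intro: maps_mp)
  show "measure (M \<Otimes>\<^sub>M M) A = 0 \<or> measure (M \<Otimes>\<^sub>M M) A = 1"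
  proof (rule T.ergodic_product[OF _ A])
    fix F C
    assume Fm: "F \<in> borel_measurable M" and C: "\<And>x. cmod (F x) \<le> C"
      and eigen: "\<And>T. T \<in> S ` {p. big key p} \<Longrightarrow> \<exists>z. AE x in M. F (T x) = z * F x"
    have "joint_eigenfunction F"
      using L2_bounded[OF Fm C] eigen by (simp add: joint_eigenfunction_def)
    then show "\<exists>c. AE x in M. F x = c" using triv by (simp add: trivial_eigenfunctions_def AE_constant_def)
  qed (use inv in auto)
qed

lemma weak_mixing_iff_trivial: "pretentiously_weak_mixing M S \<longleftrightarrow> trivial_eigenfunctions"
  using trivial_if_weak_mixing weak_mixing_if_trivial by blast

lemma comp_mult_norm: "f \<in> comp_mult \<Longrightarrow> prime p \<Longrightarrow> cmod (f p) = 1"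
  using prime_ge_1_nat by (simp add: comp_mult_def)

lemma one_comp_mult: "one_fun \<in> comp_mult"
  by (simp add: comp_mult_def)

lemma pret_space_joint: "f \<in> comp_mult \<Longrightarrow> F \<in> pret_space M S f \<Longrightarrow> joint_eigenfunction F"
  using pret_space_joint_eigenfunction comp_mult_norm by blast

text \<open>For F = c the summand at p is |c|^2 |f p - 1|^2 / p, so the distance of F to f is |c|
  times the distance of f to 1.\<close>

lemma constant_in_pret_space:
  assumes f: "f \<in> comp_mult" and F: "F \<in> pret_space M S f" and c: "AE x in M. F x = c" "c \<noteq> 0"
  shows "mult_dist f one_fun < \<infinity>"
proof -
  have [measurable]: "F \<in> borel_measurable M" using F by (simp add: pret_space_def L2_def)
  have eq: "(LINT x|M. (cmod (F (S p x) - f p * F x))\<^sup>2) = (cmod c)\<^sup>2 * (cmod (f p - 1))\<^sup>2" if p: "prime p" for p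
  proof -
    have [measurable]: "S p \<in> M \<rightarrow>\<^sub>M M" by (rule mp_map_measurable[OF maps_mp[OF p]])
    have "AE x in M. F (S p x) = c" by (rule mp_map_AE[OF maps_mp[OF p] c(1)])
    with c(1) have ae: "AE x in M. (cmod (F (S p x) - f p * F x))\<^sup>2 = (cmod c)\<^sup>2 * (cmod (f p - 1))\<^sup>2"
    proof eventually_elim
      case (elim x)
      have "cmod (c - f p * c) = cmod (c * (1 - f p))" by (simp add: algebra_simps)
      then show ?case using elim by (simp add: norm_mult power_mult_distrib norm_minus_commute)
    qed
    have "(LINT x|M. (cmod (F (S p x) - f p * F x))\<^sup>2) = (LINT x|M. (cmod c)\<^sup>2 * (cmod (f p - 1))\<^sup>2)"
      by (rule integral_cong_AE[OF _ _ ae]) measurable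
    then show ?thesis by (simp add: prob_space)
  qed
  have "(\<lambda>p. (LINT x|M. (cmod (F (S p x) - f p * F x))\<^sup>2) / real p) summable_on {p. prime p}"
    using F by (simp add: pret_space_iff)
  then have "(\<lambda>p. (cmod c)\<^sup>2 * ((cmod (f p - 1))\<^sup>2 / real p)) summable_on {p. prime p}"
    by (rule summable_on_cong[THEN iffD1, rotated]) (simp add: eq)
  then have "(\<lambda>p. (cmod (f p - 1))\<^sup>2 / real p) summable_on {p. prime p}"
    using c(2) by (subst (asm) summable_on_cmult_right') auto
  then show ?thesis using comp_mult_norm[OF f] by (subst mult_dist_less_top_iff) auto
qed

lemma zero_in_pret_space:
  assumes f: "f \<in> comp_mult" and F: "F \<in> L2 M" and z: "AE x in M. F x = 0"
  shows "F \<in> pret_space M S f"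
proof (rule pret_spaceI[OF F])
  fix p assume "big key p"
  then have "AE x in M. F (S p x) = 0" by (intro mp_map_AE[OF maps_mp z]) (simp add: big_def)
  with z show "AE x in M. F (S p x) = f p * F x" by eventually_elim simp
qed (use f comp_mult_norm in blast)

lemma invariant_if_close_to_one:
  assumes "f \<in> comp_mult_fg" "mult_dist f one_fun < \<infinity>" "big key p"
    and "\<And>p. big key p \<Longrightarrow> AE x in M. F (S p x) = f p * F x"
    and "\<And>p q. big key p \<Longrightarrow> q \<in> prime_class key p \<Longrightarrow> f q = f p"
  shows "AE x in M. F (S p x) = F x"
proof -
  have "f p = 1"
    using assms by (intro eigenvalue_one_if_pretentious) (auto simp: comp_mult_fg_def)
  then show ?thesis using assms(4)[OF assms(3)] by simp
qed

text \<open>For the converse, take the f rebuilt from a joint eigenfunction F. Either f is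
  infinitely far from 1 and F vanishes, or divergence over each big class forces f = 1 there and F
  lies in the space of \<open>one_fun\<close>.\<close>

lemma trivial_iff_pret_spaces_trivial:
  "trivial_eigenfunctions \<longleftrightarrow>
     (\<forall>F\<in>pret_space M S one_fun. AE_constant M F) \<and>
     (\<forall>f\<in>comp_mult_fg. mult_dist f one_fun = \<infinity> \<longrightarrow>
        pret_space M S f = {F \<in> L2 M. AE x in M. F x = 0})" (is "_ \<longleftrightarrow> ?A \<and> ?B")
proof
  assume triv: trivial_eigenfunctions
  have const: "AE_constant M F" if "f \<in> comp_mult" "F \<in> pret_space M S f" for f F
    using triv pret_space_joint[OF that] by (simp add: trivial_eigenfunctions_def)
  have ?B
  proof (intro ballI impI equalityI subsetI)
    fix f F assume f: "f \<in> comp_mult_fg" and d: "mult_dist f one_fun = \<infinity>" and F: "F \<in> pret_space M S f"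
    have f': "f \<in> comp_mult" using f by (simp add: comp_mult_fg_def)
    obtain c where c: "AE x in M. F x = c" using const[OF f' F] by (auto simp: AE_constant_def)
    then have "c = 0" using constant_in_pret_space[OF f' F c] d by auto
    then show "F \<in> {F \<in> L2 M. AE x in M. F x = 0}" using c F by (simp add: pret_space_def)
  next
    fix f F assume "f \<in> comp_mult_fg" "F \<in> {F \<in> L2 M. AE x in M. F x = 0}"
    then show "F \<in> pret_space M S f" by (intro zero_in_pret_space) (auto simp: comp_mult_fg_def)
  qed
  then show "?A \<and> ?B" using const[OF one_comp_mult] by blast
next
  assume AB: "?A \<and> ?B"
  show trivial_eigenfunctions unfolding trivial_eigenfunctions_def
  proof (intro allI impI)
    fix F assume F: "joint_eigenfunction F"
    obtain f where f: "f \<in> comp_mult_fg" "F \<in> pret_space M S f"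
      "\<And>p. big key p \<Longrightarrow> AE x in M. F (S p x) = f p * F x"
      "\<And>p q. big key p \<Longrightarrow> q \<in> prime_class key p \<Longrightarrow> f q = f p"
      using joint_eigenfunction_pret_space[OF F] by blast
    show "AE_constant M F"
    proof (cases "mult_dist f one_fun = \<infinity>")
      case True
      then have "AE x in M. F x = 0" using AB f(1,2) by blast
      then show ?thesis unfolding AE_constant_def ..
    next
      case False
      then have "mult_dist f one_fun < \<infinity>" by (simp add: less_top)
      then have "AE x in M. F (S p x) = 1 * F x" if "big key p" for p
        using invariant_if_close_to_one[OF f(1) _ that f(3,4)] by simp
      then have "F \<in> pret_space M S one_fun"
        using F by (intro pret_spaceI) (auto simp: joint_eigenfunction_def)
      then show ?thesis using AB by blast
    qed
  qed
qed

text \<open>An eigenfunction for an arbitrary f is one for some f with finitely many values on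
  primes: passing through the joint eigenfunctions makes the exchange.\<close>

lemma trivial_iff_no_pretentious_eigenfunction:
  "trivial_eigenfunctions \<longleftrightarrow> \<not> (\<exists>F. pretentious_eigenfunction M S F \<and> \<not> AE_constant M F)"
proof -
  have "pretentious_eigenfunction M S F \<longleftrightarrow> joint_eigenfunction F" for F
  proof
    assume "pretentious_eigenfunction M S F"
    then show "joint_eigenfunction F" using pret_space_joint unfolding pretentious_eigenfunction_def by blast
  next
    assume "joint_eigenfunction F"
    then obtain f where "f \<in> comp_mult_fg" "F \<in> pret_space M S f" by (rule joint_eigenfunction_pret_space)
    then show "pretentious_eigenfunction M S F"
      unfolding pretentious_eigenfunction_def comp_mult_fg_def by blast
  qed
  then show ?thesis by (simp add: trivial_eigenfunctions_def)
qed

lemma mult_dist_triangle_one: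
  assumes f: "f \<in> comp_mult" and g: "g \<in> comp_mult"
    and fg: "mult_dist f g < \<infinity>" and f1: "mult_dist f one_fun < \<infinity>"
  shows "mult_dist one_fun g < \<infinity>"
proof -
  note norms = comp_mult_norm[OF f] comp_mult_norm[OF g] comp_mult_norm[OF one_comp_mult]
  have "(\<lambda>p. (cmod (f p - g p))\<^sup>2 / real p) summable_on {p. prime p}"
    using fg norms by (subst (asm) mult_dist_less_top_iff) auto
  moreover have "(\<lambda>p. (cmod (f p - 1))\<^sup>2 / real p) summable_on {p. prime p}"
    using f1 norms by (subst (asm) mult_dist_less_top_iff) auto
  ultimately have "(\<lambda>p. 2 * ((cmod (f p - g p))\<^sup>2 / real p) + 2 * ((cmod (f p - 1))\<^sup>2 / real p)) summable_on {p. prime p}"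
    by (intro summable_on_add summable_on_cmult_right)
  then have "(\<lambda>p. (cmod (1 - g p))\<^sup>2 / real p) summable_on {p. prime p}"
  proof (rule summable_on_comparison_test)
    fix p :: nat
    have "cmod (1 - g p) \<le> cmod (f p - g p) + cmod (f p - 1)"
      using norm_triangle_ineq4[of "f p - g p" "f p - 1"] by simp
    then have "(cmod (1 - g p))\<^sup>2 \<le> (cmod (f p - g p) + cmod (f p - 1))\<^sup>2" by (intro power_mono) auto
    also have "\<dots> \<le> 2 * (cmod (f p - g p))\<^sup>2 + 2 * (cmod (f p - 1))\<^sup>2"
      using sum_squares_bound[of "cmod (f p - g p)" "cmod (f p - 1)"] by (simp add: power2_sum)
    finally have "(cmod (1 - g p))\<^sup>2 / real p \<le> (2 * (cmod (f p - g p))\<^sup>2 + 2 * (cmod (f p - 1))\<^sup>2) / real p"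
      by (rule divide_right_mono) simp
    then show "(cmod (1 - g p))\<^sup>2 / real p \<le> 2 * ((cmod (f p - g p))\<^sup>2 / real p) + 2 * ((cmod (f p - 1))\<^sup>2 / real p)"
      by (simp add: add_divide_distrib)
  qed simp
  then show ?thesis using norms by (subst mult_dist_less_top_iff) auto
qed

lemma sys_dist_finite_iff:
  "sys_dist M S f < \<infinity> \<longleftrightarrow> (\<exists>F\<in>pret_space M S f. L2_nrm M F = 1)"
  unfolding sys_dist_def INF_less_iff pret_space_def by blast

text \<open>If all eigenfunctions are constant, one of norm 1 for f forces f near 1, and the
  constant 1 shows that the class of 1 occurs. Conversely a nonzero joint eigenfunction, normalised,
  puts its f into the spectrum; so f is near 1, F is invariant at big primes, and ergodicity makes
  it constant.\<close>

lemma trivial_iff_spectrum: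
  "trivial_eigenfunctions \<longleftrightarrow>
     pretentiously_ergodic M S \<and> pretentious_spectrum M S = pretentious_class one_fun"
proof
  assume triv: trivial_eigenfunctions
  have const: "AE_constant M F" if "f \<in> comp_mult" "F \<in> pret_space M S f" for f F
    using triv pret_space_joint[OF that] by (simp add: trivial_eigenfunctions_def)
  have "pretentiously_ergodic M S"
    unfolding pretentiously_ergodic_def
  proof (intro ballI impI)
    fix A assume A: "A \<in> sets M" and "indicator A \<in> pret_space M S one_fun"
    then obtain c :: complex where c: "AE x in M. indicator A x = c"
      using const[OF one_comp_mult] unfolding AE_constant_def by blast
    show "measure M A = 0 \<or> measure M A = 1"
    proof (cases "c = 0")
      case True
      from c have "AE x in M. x \<notin> A" by eventually_elim (use True in \<open>auto simp: indicator_def\<close>)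
      then show ?thesis using A by (simp add: prob_eq_0)
    next
      case False
      from c have "AE x in M. x \<in> A" by eventually_elim (use False in \<open>auto simp: indicator_def\<close>)
      then show ?thesis using A by (simp add: prob_eq_1)
    qed
  qed
  moreover have "pretentious_spectrum M S = pretentious_class one_fun"
  proof (intro equalityI subsetI)
    fix g assume "g \<in> pretentious_spectrum M S"
    then obtain f F where f: "f \<in> comp_mult" "g \<in> pretentious_class f"
      and F: "F \<in> pret_space M S f" "L2_nrm M F = 1"
      unfolding pretentious_spectrum_def sys_dist_finite_iff by blast
    obtain c where c: "AE x in M. F x = c" using const[OF f(1) F(1)] by (auto simp: AE_constant_def)
    have "c \<noteq> 0"
    proof
      assume "c = 0"
      then have "(LINT x|M. (cmod (F x))\<^sup>2) = 0"
        by (intro integral_eq_zero_AE) (use c in \<open>eventually_elim, simp\<close>)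
      then show False using F(2) by (simp add: L2_nrm_def)
    qed
    then have "mult_dist f one_fun < \<infinity>" by (rule constant_in_pret_space[OF f(1) F(1) c])
    then show "g \<in> pretentious_class one_fun"
      using f mult_dist_triangle_one[of f g] by (simp add: pretentious_class_def)
  next
    fix g assume "g \<in> pretentious_class one_fun"
    moreover have "(\<lambda>_. 1) \<in> pret_space M S one_fun"
      by (intro pret_spaceI L2_bounded[where C=1]) auto
    moreover have "L2_nrm M (\<lambda>_. 1) = 1" by (simp add: L2_nrm_def prob_space)
    ultimately show "g \<in> pretentious_spectrum M S"
      unfolding pretentious_spectrum_def sys_dist_finite_iff using one_comp_mult by blast
  qed
  ultimately show "pretentiously_ergodic M S \<and> pretentious_spectrum M S = pretentious_class one_fun" ..
next
  assume asm: "pretentiously_ergodic M S \<and> pretentious_spectrum M S = pretentious_class one_fun"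
  show trivial_eigenfunctions unfolding trivial_eigenfunctions_def
  proof (intro allI impI)
    fix F assume F: "joint_eigenfunction F"
    then have FL: "F \<in> L2 M" by (simp add: joint_eigenfunction_def)
    have Fm: "F \<in> borel_measurable M" by (rule L2_measurable[OF FL])
    obtain f where f: "f \<in> comp_mult_fg" "F \<in> pret_space M S f"
      "\<And>p. big key p \<Longrightarrow> AE x in M. F (S p x) = f p * F x"
      "\<And>p q. big key p \<Longrightarrow> q \<in> prime_class key p \<Longrightarrow> f q = f p"
      using joint_eigenfunction_pret_space[OF F] by blast
    have f': "f \<in> comp_mult" using f(1) by (simp add: comp_mult_fg_def)
    show "AE_constant M F"
    proof (cases "AE x in M. F x = 0")
      case True
      then show ?thesis unfolding AE_constant_def ..
    next
      case False
      define r where "r = L2_nrm M F"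
      have r0: "r \<noteq> 0"
        using False integral_nonneg_eq_0_iff_AE[OF L2_integrable[OF FL]] by (simp add: r_def L2_nrm_def)
      define G where "G x = F x / of_real r" for x
      have GL: "G \<in> L2 M"
        using FL unfolding G_def L2_def by (auto simp: norm_divide power_divide)
      have "(L2_nrm M G)\<^sup>2 = 1\<^sup>2"
        using r0 by (simp add: L2_nrm_square G_def norm_divide power_divide) (simp add: r_def L2_nrm_square)
      then have "L2_nrm M G = 1"
        by (subst (asm) power2_eq_iff_nonneg) (auto simp: L2_nrm_def integral_nonneg_AE)
      moreover have "G \<in> pret_space M S f"
      proof (rule pret_spaceI[OF GL])
        show "AE x in M. G (S p x) = f p * G x" if "big key p" for p
          using f(3)[OF that] by eventually_elim (simp add: G_def)
      qed (use f' comp_mult_norm in blast)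
      ultimately have "sys_dist M S f < \<infinity>" unfolding sys_dist_finite_iff by blast
      moreover have "mult_dist f f < \<infinity>"
        using comp_mult_norm[OF f'] by (subst mult_dist_less_top_iff) auto
      ultimately have "f \<in> pretentious_spectrum M S"
        using f' by (auto simp: pretentious_spectrum_def pretentious_class_def)
      then have "mult_dist one_fun f < \<infinity>" using asm by (simp add: pretentious_class_def)
      then have "mult_dist f one_fun < \<infinity>"
        using comp_mult_norm[OF f'] by (simp add: mult_dist_less_top_iff norm_minus_commute del: infinity_ennreal_def)
      then show ?thesis
        using asm invariant_if_close_to_one[OF f(1) _ _ f(3,4)] Fm by (intro ergodic_invariant_constant) auto
    qed
  qed
qed

end

theorem corollary1p18:
  fixes M :: "'a::metric_space measure" and S :: "nat \<Rightarrow> 'a \<Rightarrow> 'a"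
  assumes "multiplicative_system M S" and "finitely_generated M S"
  shows
    "(pretentiously_weak_mixing M S \<longleftrightarrow>
        (\<forall>F\<in>pret_space M S one_fun. AE_constant M F) \<and>
        (\<forall>f\<in>comp_mult_fg. mult_dist f one_fun = \<infinity> \<longrightarrow>
           pret_space M S f = {F \<in> L2 M. AE x in M. F x = 0})) \<and>
     (pretentiously_weak_mixing M S \<longleftrightarrow>
        pretentiously_ergodic M S \<and> pretentious_spectrum M S = pretentious_class one_fun) \<and>
     (pretentiously_weak_mixing M S \<longleftrightarrow>
        \<not> (\<exists>F. pretentious_eigenfunction M S F \<and> \<not> AE_constant M F))"
proof -
  interpret finitely_generated_system M S
    using assms by (simp add: finitely_generated_system_def finitely_generated_system_axioms_def)
  show ?thesis
    unfolding weak_mixing_iff_trivial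
    using trivial_iff_pret_spaces_trivial trivial_iff_spectrum trivial_iff_no_pretentious_eigenfunction
    by blast
qed

end
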